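(* Let $C$ be a diamond category with countably many isomorphism classes, $\mathcal{P}$ its category of pro-objects, and $\mu$ a probability measure on $\mathcal{P}/\cong$ with finite moments $M_G=\int_{\mathcal{P}}\#\mathrm{Epi}(\mathscr{G},G)\,d\mu(\mathscr{G})$. Let $f_n:C/\cong\to\mathbb{R}$ be a real-valued $L^1$-ordering. Then \[ \int_{\mathcal{P}}\left|N(\mathscr{G},f_n)-\int_C f_n\,dM\right|^2 d\mu(\mathscr{G}) \ll \max_{j\in\{1,2\}}\int_{C^2\setminus E(2,M)}|f_n|\,dM^{(j)}(dM)^{2-j}, \] where $E(2,M)\subseteq C^2$ is the full subcategory of pairs $(G_1,G_2)$ such that (a) the epi-product $G_1\times_{\mathrm{Epi}}G_2$ exists, and (b) $M_{G_1\times_{\mathrm{Epi}}G_2}=M_{G_1}M_{G_2}$.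
   Context: Diamond category in the sense of Sawin–Wood; $\mu$ is a Borel probability measure on isomorphism classes of pro-objects (level topology), and $\mathrm{Epi}(\mathscr{G},G)$ is finite for $G\in C$, $\mathscr{G}\in\mathcal{P}$. $M$ is the discrete measure on $C/\cong$ with $M(\{G\})=M_G$. An $L^1$-ordering is a sequence $f_n:C/\cong\to\mathbb{C}$ with $\sum_G|f_n(G)|M_G<\infty$ for each $n$; $N(\mathscr{G},f_n)=\sum_{G\in C/\cong}f_n(G)\#\mathrm{Epi}(\mathscr{G},G)$. The ordering is extended to $C^k/\cong$ by $f_n(G_1,\dots,G_k)=f_n(G_1)\cdots f_n(G_k)$. The mixed moments are $M^{(j)}_{(G_1,\dots,G_j)}=\int_{\mathcal{P}}\prod_{i=1}^j\#\mathrm{Epi}(\mathscr{G},G_i)\,d\mu(\mathscr{G})\in\mathbb{R}_{\ge0}\cup\{\infty\}$, and for a subset $S\subseteq C^k/\cong$, $\int_S |f_n|\,dM^{(j)}(dM)^{k-j}$ means $\sum_{(G_1,\dots,G_k)\in S}|f_n(G_1,\dots,G_k)|\,M^{(j)}_{(G_1,\dots,G_j)}M_{G_{j+1}}\cdots M_{G_k}$. The epi-product of $G_1,G_2$ is an object $G_1\times_{\mathrm{Epi}}G_2$ with epimorphisms to $G_1$ and $G_2$ such that for every object $H$ with epimorphisms $H\to G_1$, $H\to G_2$ there is a unique morphism $H\to G_1\times_{\mathrm{Epi}}G_2$ compatible with them, and this morphism is an epimorphism. *)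

theory Defs
  imports "HOL-Algebra.Lattice" "HOL-Probability.Probability"
begin

section \<open>Categories\<close>

record ('o, 'a) cat =
  Ob :: "'o set"
  Arr :: "'a set"
  Dom :: "'a \<Rightarrow> 'o"
  Cod :: "'a \<Rightarrow> 'o"
  Ident :: "'o \<Rightarrow> 'a"
  Comp :: "'a \<Rightarrow> 'a \<Rightarrow> 'a"  \<comment> \<open>\<open>Comp C g f\<close> is \<open>g\<close> after \<open>f\<close>\<close>

definition hom_set :: "('o, 'a) cat \<Rightarrow> 'o \<Rightarrow> 'o \<Rightarrow> 'a set" where
  "hom_set C A B = {f \<in> Arr C. Dom C f = A \<and> Cod C f = B}"

definition category :: "('o, 'a) cat \<Rightarrow> bool" where
  "category C \<longleftrightarrow>
     (\<forall>f\<in>Arr C. Dom C f \<in> Ob C \<and> Cod C f \<in> Ob C) \<and>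
     (\<forall>A\<in>Ob C. Ident C A \<in> hom_set C A A) \<and>
     (\<forall>f\<in>Arr C. \<forall>g\<in>Arr C. Dom C g = Cod C f \<longrightarrow> Comp C g f \<in> hom_set C (Dom C f) (Cod C g)) \<and>
     (\<forall>f\<in>Arr C. Comp C f (Ident C (Dom C f)) = f \<and> Comp C (Ident C (Cod C f)) f = f) \<and>
     (\<forall>f\<in>Arr C. \<forall>g\<in>Arr C. \<forall>h\<in>Arr C. Dom C g = Cod C f \<longrightarrow> Dom C h = Cod C g \<longrightarrow>
        Comp C h (Comp C g f) = Comp C (Comp C h g) f)"

definition is_iso :: "('o, 'a) cat \<Rightarrow> 'a \<Rightarrow> bool" where
  "is_iso C f \<longleftrightarrow> f \<in> Arr C \<and>
     (\<exists>g\<in>hom_set C (Cod C f) (Dom C f).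
        Comp C g f = Ident C (Dom C f) \<and> Comp C f g = Ident C (Cod C f))"

definition is_epi :: "('o, 'a) cat \<Rightarrow> 'a \<Rightarrow> bool" where
  "is_epi C f \<longleftrightarrow> f \<in> Arr C \<and>
     (\<forall>g\<in>Arr C. \<forall>h\<in>Arr C. Dom C g = Cod C f \<longrightarrow> Dom C h = Cod C f \<longrightarrow>
        Comp C g f = Comp C h f \<longrightarrow> g = h)"

definition epis :: "('o, 'a) cat \<Rightarrow> 'o \<Rightarrow> 'o \<Rightarrow> 'a set" where
  "epis C A B = {f \<in> hom_set C A B. is_epi C f}"

definition isomorphism_rel :: "('o, 'a) cat \<Rightarrow> ('o \<times> 'o) set" where
  "isomorphism_rel C = {(A, B). A \<in> Ob C \<and> B \<in> Ob C \<and> (\<exists>f\<in>hom_set C A B. is_iso C f)}"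

definition iso_class :: "('o, 'a) cat \<Rightarrow> 'o \<Rightarrow> 'o set" where
  "iso_class C A = isomorphism_rel C `` {A}"

definition iso_classes :: "('o, 'a) cat \<Rightarrow> 'o set set" where
  "iso_classes C = Ob C // isomorphism_rel C"

section \<open>Diamond categories\<close>

definition quotients :: "('o, 'a) cat \<Rightarrow> 'o \<Rightarrow> 'a set" where
  "quotients C G = {p. is_epi C p \<and> Dom C p = G}"

definition quotient_iso :: "('o, 'a) cat \<Rightarrow> 'o \<Rightarrow> ('a \<times> 'a) set" where
  "quotient_iso C G = {(p, q). p \<in> quotients C G \<and> q \<in> quotients C G \<and>
     (\<exists>h\<in>hom_set C (Cod C p) (Cod C q). is_iso C h \<and> q = Comp C h p)}"

text \<open>The larger quotient is the one that maps to the other; \<open>G\<close> itself is the top element.\<close>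

definition quotient_poset :: "('o, 'a) cat \<Rightarrow> 'o \<Rightarrow> 'a set gorder" where
  "quotient_poset C G =
     \<lparr>carrier = quotients C G // quotient_iso C G,
      eq = (=),
      le = (\<lambda>P Q. \<exists>p\<in>P. \<exists>q\<in>Q. \<exists>h\<in>hom_set C (Cod C q) (Cod C p). p = Comp C h q)\<rparr>"

definition modular_lattice :: "'a gorder \<Rightarrow> bool" where
  "modular_lattice L \<longleftrightarrow> Lattice.lattice L \<and>
     (\<forall>a\<in>carrier L. \<forall>b\<in>carrier L. \<forall>x\<in>carrier L.
        a \<sqsubseteq>\<^bsub>L\<^esub> b \<longrightarrow> a \<squnion>\<^bsub>L\<^esub> (x \<sqinter>\<^bsub>L\<^esub> b) = (a \<squnion>\<^bsub>L\<^esub> x) \<sqinter>\<^bsub>L\<^esub> b)"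

definition minimal_object :: "('o, 'a) cat \<Rightarrow> 'o \<Rightarrow> bool" where
  "minimal_object C G \<longleftrightarrow> G \<in> Ob C \<and> (\<forall>p\<in>quotients C G. is_iso C p)"

definition downward_closed :: "('o, 'a) cat \<Rightarrow> 'o set \<Rightarrow> bool" where
  "downward_closed C W \<longleftrightarrow> (\<forall>G\<in>W. \<forall>p\<in>quotients C G. Cod C p \<in> W)"

definition join_closed :: "('o, 'a) cat \<Rightarrow> 'o set \<Rightarrow> bool" where
  "join_closed C W \<longleftrightarrow>
     (\<forall>G\<in>Ob C. \<forall>p\<in>quotients C G. \<forall>q\<in>quotients C G. \<forall>r\<in>quotients C G.
        Cod C p \<in> W \<longrightarrow> Cod C q \<in> W \<longrightarrow>
        least (quotient_poset C G) (quotient_iso C G `` {r})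
          (Upper (quotient_poset C G) {quotient_iso C G `` {p}, quotient_iso C G `` {q}}) \<longrightarrow>
        Cod C r \<in> W)"

text \<open>
  Sets of isomorphism classes are represented by sets of objects; downward closure makes a
  formation closed under isomorphism, since isomorphisms are epimorphisms.
\<close>

definition formation :: "('o, 'a) cat \<Rightarrow> 'o set \<Rightarrow> bool" where
  "formation C W \<longleftrightarrow> W \<subseteq> Ob C \<and> downward_closed C W \<and> join_closed C W \<and>
     (\<forall>G. minimal_object C G \<longrightarrow> G \<in> W)"

definition level :: "('o, 'a) cat \<Rightarrow> 'o set \<Rightarrow> bool" where
  "level C W \<longleftrightarrow> (\<exists>V. finite V \<and> V \<subseteq> Ob C \<and> W = \<Inter>{W'. formation C W' \<and> V \<subseteq> W'})"

definition simple_epi :: "('o, 'a) cat \<Rightarrow> 'a \<Rightarrow> bool" where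
  "simple_epi C f \<longleftrightarrow> is_epi C f \<and> \<not> is_iso C f \<and>
     (\<forall>g h. is_epi C g \<longrightarrow> is_epi C h \<longrightarrow> Dom C g = Cod C h \<longrightarrow> f = Comp C g h \<longrightarrow>
        is_iso C g \<or> is_iso C h)"

definition diamond_category :: "('o, 'a) cat \<Rightarrow> bool" where
  "diamond_category C \<longleftrightarrow> category C \<and>
     (\<forall>G\<in>Ob C. finite (carrier (quotient_poset C G)) \<and> modular_lattice (quotient_poset C G)) \<and>
     (\<forall>G\<in>Ob C. finite {f \<in> hom_set C G G. is_iso C f}) \<and>
     (\<forall>W. level C W \<longrightarrow> (\<forall>G\<in>W.
        finite (iso_class C ` {F \<in> W. \<exists>f\<in>hom_set C F G. simple_epi C f})))"

definition is_epi_product ::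
    "('o, 'a) cat \<Rightarrow> 'o \<Rightarrow> 'o \<Rightarrow> 'o \<Rightarrow> 'a \<Rightarrow> 'a \<Rightarrow> bool" where
  "is_epi_product C A B P p q \<longleftrightarrow> p \<in> epis C P A \<and> q \<in> epis C P B \<and>
     (\<forall>H\<in>Ob C. \<forall>a\<in>epis C H A. \<forall>b\<in>epis C H B.
        (\<exists>!h. h \<in> hom_set C H P \<and> Comp C p h = a \<and> Comp C q h = b) \<and>
        (\<forall>h\<in>hom_set C H P. Comp C p h = a \<longrightarrow> Comp C q h = b \<longrightarrow> is_epi C h))"

section \<open>Pro-objects\<close>

text \<open>
  A pro-object is a functor from a cofiltered category, with objects in \<open>'i\<close> and arrows in \<open>'j\<close>.
  Both types are arbitrary: they take the role of the universe in ``small cofiltered category''.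
\<close>

record ('i, 'j, 'o, 'a) pro =
  Idx :: "('i, 'j) cat"
  PObj :: "'i \<Rightarrow> 'o"
  PArr :: "'j \<Rightarrow> 'a"

definition cofiltered :: "('i, 'j) cat \<Rightarrow> bool" where
  "cofiltered I \<longleftrightarrow> category I \<and> Ob I \<noteq> {} \<and>
     (\<forall>i\<in>Ob I. \<forall>j\<in>Ob I. \<exists>k\<in>Ob I. hom_set I k i \<noteq> {} \<and> hom_set I k j \<noteq> {}) \<and>
     (\<forall>i\<in>Ob I. \<forall>j\<in>Ob I. \<forall>u\<in>hom_set I i j. \<forall>v\<in>hom_set I i j.
        \<exists>k\<in>Ob I. \<exists>w\<in>hom_set I k i. Comp I u w = Comp I v w)"

definition pro_object :: "('o, 'a) cat \<Rightarrow> ('i, 'j, 'o, 'a) pro \<Rightarrow> bool" where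
  "pro_object C X \<longleftrightarrow> cofiltered (Idx X) \<and>
     (\<forall>i\<in>Ob (Idx X). PObj X i \<in> Ob C \<and> PArr X (Ident (Idx X) i) = Ident C (PObj X i)) \<and>
     (\<forall>u\<in>Arr (Idx X). PArr X u \<in> hom_set C (PObj X (Dom (Idx X) u)) (PObj X (Cod (Idx X) u))) \<and>
     (\<forall>u\<in>Arr (Idx X). \<forall>v\<in>Arr (Idx X). Dom (Idx X) v = Cod (Idx X) u \<longrightarrow>
        PArr X (Comp (Idx X) v u) = Comp C (PArr X v) (PArr X u))"

text \<open>\<open>colim_hom C X G\<close> is the filtered colimit over \<open>i\<close> of the sets \<open>Hom(X i, G)\<close>.\<close>

definition colim_reps :: "('o, 'a) cat \<Rightarrow> ('i, 'j, 'o, 'a) pro \<Rightarrow> 'o \<Rightarrow> ('i \<times> 'a) set" where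
  "colim_reps C X G = (SIGMA i : Ob (Idx X). hom_set C (PObj X i) G)"

definition colim_rel ::
    "('o, 'a) cat \<Rightarrow> ('i, 'j, 'o, 'a) pro \<Rightarrow> 'o \<Rightarrow> (('i \<times> 'a) \<times> ('i \<times> 'a)) set" where
  "colim_rel C X G = {((i, f), (j, g)).
     (i, f) \<in> colim_reps C X G \<and> (j, g) \<in> colim_reps C X G \<and>
     (\<exists>k\<in>Ob (Idx X). \<exists>u\<in>hom_set (Idx X) k i. \<exists>v\<in>hom_set (Idx X) k j.
        Comp C f (PArr X u) = Comp C g (PArr X v))}"

definition colim_hom :: "('o, 'a) cat \<Rightarrow> ('i, 'j, 'o, 'a) pro \<Rightarrow> 'o \<Rightarrow> ('i \<times> 'a) set set" where
  "colim_hom C X G = colim_reps C X G // colim_rel C X G"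

definition postcomp ::
    "('o, 'a) cat \<Rightarrow> ('i, 'j, 'o, 'a) pro \<Rightarrow> 'a \<Rightarrow> ('i \<times> 'a) set \<Rightarrow> ('i \<times> 'a) set" where
  "postcomp C X h c = colim_rel C X (Cod C h) `` {(i, Comp C h f) | i f. (i, f) \<in> c}"

text \<open>
  \<open>Hom(X, Y)\<close> is the limit over \<open>k\<close> of \<open>colim_hom C X (Y k)\<close>; an arrow of the category of
  pro-objects records its source and target together with such a compatible family.
\<close>

definition pro_hom :: "('o, 'a) cat \<Rightarrow> ('i, 'j, 'o, 'a) pro \<Rightarrow> ('i, 'j, 'o, 'a) pro \<Rightarrow>
    ('i \<Rightarrow> ('i \<times> 'a) set) set" where
  "pro_hom C X Y = {\<phi> \<in> (\<Pi>\<^sub>E k \<in> Ob (Idx Y). colim_hom C X (PObj Y k)).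
     \<forall>w\<in>Arr (Idx Y). postcomp C X (PArr Y w) (\<phi> (Dom (Idx Y) w)) = \<phi> (Cod (Idx Y) w)}"

type_synonym ('i, 'j, 'o, 'a) pro_arrow =
  "('i, 'j, 'o, 'a) pro \<times> ('i, 'j, 'o, 'a) pro \<times> ('i \<Rightarrow> ('i \<times> 'a) set)"

definition pro_ident :: "('o, 'a) cat \<Rightarrow> ('i, 'j, 'o, 'a) pro \<Rightarrow> ('i, 'j, 'o, 'a) pro_arrow" where
  "pro_ident C X =
     (X, X, \<lambda>k\<in>Ob (Idx X). colim_rel C X (PObj X k) `` {(k, Ident C (PObj X k))})"

fun pro_comp :: "('o, 'a) cat \<Rightarrow> ('i, 'j, 'o, 'a) pro_arrow \<Rightarrow> ('i, 'j, 'o, 'a) pro_arrow \<Rightarrow>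
    ('i, 'j, 'o, 'a) pro_arrow" where
  "pro_comp C (Y, Z, \<psi>) (X, Y', \<phi>) =
     (X, Z, \<lambda>m\<in>Ob (Idx Z). \<Union>(k, g)\<in>\<psi> m. postcomp C X g (\<phi> k))"

definition Pro :: "('o, 'a) cat \<Rightarrow> (('i, 'j, 'o, 'a) pro, ('i, 'j, 'o, 'a) pro_arrow) cat" where
  "Pro C =
     \<lparr>Ob = {X. pro_object C X},
      Arr = {(X, Y, \<phi>). pro_object C X \<and> pro_object C Y \<and> \<phi> \<in> pro_hom C X Y},
      Dom = fst,
      Cod = (\<lambda>f. fst (snd f)),
      Ident = pro_ident C,
      Comp = pro_comp C\<rparr>"

text \<open>An object of \<open>C\<close>, viewed as the pro-object indexed by the category with one arrow.\<close>

definition const_pro :: "('o, 'a) cat \<Rightarrow> 'o \<Rightarrow> ('i, 'j, 'o, 'a) pro" where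
  "const_pro C G =
     \<lparr>Idx = \<lparr>Ob = {undefined}, Arr = {undefined}, Dom = (\<lambda>_. undefined), Cod = (\<lambda>_. undefined),
             Ident = (\<lambda>_. undefined), Comp = (\<lambda>_ _. undefined)\<rparr>,
      PObj = (\<lambda>_. G),
      PArr = (\<lambda>_. Ident C G)\<rparr>"

definition pro_epis ::
    "('o, 'a) cat \<Rightarrow> ('i, 'j, 'o, 'a) pro \<Rightarrow> 'o \<Rightarrow> ('i, 'j, 'o, 'a) pro_arrow set" where
  "pro_epis C X G = epis (Pro C) X (const_pro C G)"

text \<open>
  The maximal quotient of \<open>X\<close> in \<open>W\<close>; since a level is join-closed, maximal means that every
  quotient of \<open>X\<close> in \<open>W\<close> factors through it.
\<close>

definition is_level_quotient ::
    "('o, 'a) cat \<Rightarrow> 'o set \<Rightarrow> ('i, 'j, 'o, 'a) pro \<Rightarrow> 'o \<Rightarrow> bool" where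
  "is_level_quotient C W X F \<longleftrightarrow> F \<in> W \<and>
     (\<exists>q\<in>pro_epis C X F. \<forall>H\<in>W. \<forall>p\<in>pro_epis C X H.
        \<exists>h\<in>hom_set (Pro C) (const_pro C F) (const_pro C H). p = Comp (Pro C) h q)"

text \<open>
  The pro-objects that admit finitely many epimorphisms to each object, and for which the
  maximal quotient in each level, on which the level topology is based, exists.
\<close>

definition small_pros :: "('o, 'a) cat \<Rightarrow> ('i, 'j, 'o, 'a) pro set" where
  "small_pros C = {X. pro_object C X \<and>
     (\<forall>G\<in>Ob C. finite (pro_epis C X G)) \<and>
     (\<forall>W. level C W \<longrightarrow> (\<exists>F. is_level_quotient C W X F))}"

definition pro_iso_classes :: "('o, 'a) cat \<Rightarrow> ('i, 'j, 'o, 'a) pro set set" where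
  "pro_iso_classes C =
     small_pros C // (isomorphism_rel (Pro C) \<inter> small_pros C \<times> small_pros C)"

definition level_topology :: "('o, 'a) cat \<Rightarrow> ('i, 'j, 'o, 'a) pro set topology" where
  "level_topology C = topology_generated_by
     {{x \<in> pro_iso_classes C. \<exists>X\<in>x. is_level_quotient C W X F} | W F. level C W \<and> F \<in> W}"

definition level_borel :: "('o, 'a) cat \<Rightarrow> ('i, 'j, 'o, 'a) pro set measure" where
  "level_borel C = sigma (pro_iso_classes C) {U. openin (level_topology C) U}"

section \<open>Moments and counting functions\<close>

text \<open>Arguments of the functions below are isomorphism classes; \<open>rep\<close> chooses an object.\<close>

definition rep :: "'x set \<Rightarrow> 'x" where
  "rep c = (SOME a. a \<in> c)"

definition epi_count :: "('o, 'a) cat \<Rightarrow> ('i, 'j, 'o, 'a) pro set \<Rightarrow> 'o set \<Rightarrow> nat" where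
  "epi_count C x G = card (pro_epis C (rep x) (rep G))"

definition moment ::
    "('o, 'a) cat \<Rightarrow> ('i, 'j, 'o, 'a) pro set measure \<Rightarrow> 'o set \<Rightarrow> ennreal" where
  "moment C \<mu> G = (\<integral>\<^sup>+x. of_nat (epi_count C x G) \<partial>\<mu>)"

definition mixed_moment ::
    "('o, 'a) cat \<Rightarrow> ('i, 'j, 'o, 'a) pro set measure \<Rightarrow> 'o set list \<Rightarrow> ennreal" where
  "mixed_moment C \<mu> Gs = (\<integral>\<^sup>+x. (\<Prod>G\<leftarrow>Gs. of_nat (epi_count C x G)) \<partial>\<mu>)"

definition moment_measure ::
    "('o, 'a) cat \<Rightarrow> ('i, 'j, 'o, 'a) pro set measure \<Rightarrow> 'o set measure" where
  "moment_measure C \<mu> = point_measure (iso_classes C) (moment C \<mu>)"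

definition L1_ordering :: "('o, 'a) cat \<Rightarrow> ('i, 'j, 'o, 'a) pro set measure \<Rightarrow>
    (nat \<Rightarrow> 'o set \<Rightarrow> 'b::real_normed_field) \<Rightarrow> bool" where
  "L1_ordering C \<mu> f \<longleftrightarrow>
     (\<forall>n. (\<Sum>\<^sub>\<infinity>G\<in>iso_classes C. ennreal (norm (f n G)) * moment C \<mu> G) < \<infinity>)"

text \<open>
  The series converges absolutely for almost every \<open>x\<close> when \<open>f\<close> is a term of an
  \<open>L\<^sup>1\<close>-ordering; \<open>infsum\<close> assigns the value \<open>0\<close> to the exceptional \<open>x\<close>.
\<close>

definition counting_fun :: "('o, 'a) cat \<Rightarrow> ('i, 'j, 'o, 'a) pro set \<Rightarrow>
    ('o set \<Rightarrow> 'b::real_normed_field) \<Rightarrow> 'b" where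
  "counting_fun C x f = (\<Sum>\<^sub>\<infinity>G\<in>iso_classes C. f G * of_nat (epi_count C x G))"

text \<open>Isomorphism classes of \<open>C\<^sup>k\<close>, as lists of length \<open>k\<close> of isomorphism classes of \<open>C\<close>.\<close>

definition tuples :: "('o, 'a) cat \<Rightarrow> nat \<Rightarrow> 'o set list set" where
  "tuples C k = {Gs. set Gs \<subseteq> iso_classes C \<and> length Gs = k}"

text \<open>The integral of \<open>|f|\<close> over \<open>S\<close> against \<open>dM\<^sup>(\<^sup>j\<^sup>) (dM)\<^sup>k\<^sup>-\<^sup>j\<close>, for \<open>S \<subseteq> tuples C k\<close>.\<close>

definition mixed_integral :: "('o, 'a) cat \<Rightarrow> ('i, 'j, 'o, 'a) pro set measure \<Rightarrow> nat \<Rightarrow>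
    'o set list set \<Rightarrow> ('o set \<Rightarrow> 'b::real_normed_field) \<Rightarrow> ennreal" where
  "mixed_integral C \<mu> j S f =
     (\<Sum>\<^sub>\<infinity>Gs\<in>S. ennreal (norm (\<Prod>G\<leftarrow>Gs. f G)) *
        mixed_moment C \<mu> (take j Gs) * (\<Prod>G\<leftarrow>drop j Gs. moment C \<mu> G))"

definition E2 ::
    "('o, 'a) cat \<Rightarrow> ('i, 'j, 'o, 'a) pro set measure \<Rightarrow> 'o set list set" where
  "E2 C \<mu> = {[A, B] | A B. A \<in> iso_classes C \<and> B \<in> iso_classes C \<and>
     (\<exists>G1\<in>A. \<exists>G2\<in>B. \<exists>P p q. is_epi_product C G1 G2 P p q \<and>
        moment C \<mu> (iso_class C P) = moment C \<mu> A * moment C \<mu> B)}"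

end

(*
  Every epimorphism from a pro-object X to an object of a level W factors uniquely through the
  maximal quotient F of X in W, and the factor F -> G is an epimorphism of C.  So the number of
  epimorphisms X -> G is the number of epimorphisms F -> G in C.  Hence the count is
  constant on the basic open sets of a level containing G, so it is measurable,
  and it gives #Epi(X, P) = #Epi(X, G1) * #Epi(X, G2) for an epi-product P of G1 and G2, because the
  universal property only speaks about objects of C.

  Expanding the square, the integral is the sum over pairs (G1, G2) of
  f(G1) f(G2) (M^(2)(G1, G2) - M(G1) M(G2)).  Pairs in E(2, M) contribute 0, and the others at most
  |f(G1) f(G2)| (M^(2)(G1, G2) + M(G1) M(G2)), so the constant is 2.  The interchange of sum and
  integral is legitimate when the right-hand side is finite: on E(2, M) the absolute values are
  controlled by the square of the L^1-norm of f.
*)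
theory Submission
  imports Defs
begin

section \<open>Epimorphisms and isomorphisms in a category\<close>

text \<open>Epimorphisms out of a pro-object are tested in \<open>Pro C\<close>, against arbitrary
  pro-objects, whereas level quotients are compared through arrows of \<open>C\<close>. Bridging the
  two takes the category axioms for \<open>Pro C\<close>, so that epimorphisms compose and cancel
  there, and the embedding of \<open>C\<close> as constant pro-objects, which has to be fully
  faithful and to preserve as well as reflect epimorphisms. Preservation is the delicate half, since
  the test object need not be constant. A level may be generated by several objects at once; taking
  \<open>G1\<close>, \<open>G2\<close> and their epi-product together makes a single quotient
  \<open>F\<close> compute all three counts, pointwise in the pro-object. The analytic part is
  stated without categories: nonnegative random variables \<open>e i\<close> with means
  \<open>m i\<close>, whose second moments are multiplicative off a set \<open>S\<close> of pairs.
  Each factor is centred before squaring, so that the expectation of a pair term is a multiple of a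
  covariance. Only the second-order sum over \<open>S\<close> can be infinite; its finiteness is the
  last bound that Fubini needs.\<close>

lemma hom_setD:
  assumes "f \<in> hom_set C A B"
  shows "f \<in> Arr C" "Dom C f = A" "Cod C f = B"
  using assms by (auto simp: hom_set_def)

lemma hom_set_Ob:
  assumes "category C" "f \<in> hom_set C A B"
  shows "A \<in> Ob C" "B \<in> Ob C"
  using assms by (auto simp: hom_set_def category_def)

lemma Ident_hom: "category C \<Longrightarrow> A \<in> Ob C \<Longrightarrow> Ident C A \<in> hom_set C A A"
  by (simp add: category_def)

lemma Comp_hom:
  "category C \<Longrightarrow> f \<in> hom_set C A B \<Longrightarrow> g \<in> hom_set C B D \<Longrightarrow> Comp C g f \<in> hom_set C A D"
  unfolding category_def hom_set_def by blast

lemma Comp_Ident: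
  assumes "category C" "f \<in> hom_set C A B"
  shows "Comp C f (Ident C A) = f" "Comp C (Ident C B) f = f"
  using assms unfolding category_def hom_set_def by blast+

lemma Comp_assoc:
  "category C \<Longrightarrow> f \<in> hom_set C A B \<Longrightarrow> g \<in> hom_set C B D \<Longrightarrow> h \<in> hom_set C D E \<Longrightarrow>
     Comp C h (Comp C g f) = Comp C (Comp C h g) f"
  unfolding category_def hom_set_def by simp

text \<open>\<open>is_epi\<close> cancels arrows \<open>g\<close>, \<open>h\<close> whose codomains
  may differ. Equal composites already have equal codomains, so it is enough to test pairs in a
  common hom-set, which is the form convenient for cancellation.\<close>

lemma epis_iff:
  assumes "category C"
  shows "f \<in> epis C A B \<longleftrightarrow> f \<in> hom_set C A B \<and>
     (\<forall>D. \<forall>g\<in>hom_set C B D. \<forall>h\<in>hom_set C B D. Comp C g f = Comp C h f \<longrightarrow> g = h)"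
    (is "_ \<longleftrightarrow> ?f \<and> ?cancel")
proof
  assume "f \<in> epis C A B"
  then show "?f \<and> ?cancel"
    unfolding epis_def is_epi_def by (auto simp: hom_set_def)
next
  assume f: "?f \<and> ?cancel"
  have "g = h" if gh: "g \<in> Arr C" "h \<in> Arr C" "Dom C g = B" "Dom C h = B"
    and eq: "Comp C g f = Comp C h f" for g h
  proof -
    have g: "g \<in> hom_set C B (Cod C g)" and h: "h \<in> hom_set C B (Cod C h)"
      using gh by (simp_all add: hom_set_def)
    have "Cod C g = Cod C h"
      using Comp_hom[OF assms conjunct1[OF f] g] Comp_hom[OF assms conjunct1[OF f] h] eq
      by (simp add: hom_set_def)
    then show "g = h"
      using f g h eq by metis
  qed
  then show "f \<in> epis C A B"
    using f unfolding epis_def is_epi_def by (simp add: hom_set_def)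
qed

lemma episD:
  assumes "category C" "f \<in> epis C A B" "g \<in> hom_set C B D" "h \<in> hom_set C B D"
    "Comp C g f = Comp C h f"
  shows "g = h"
  using assms epis_iff by metis

lemma epis_hom: "f \<in> epis C A B \<Longrightarrow> f \<in> hom_set C A B"
  by (simp add: epis_def)

lemma Comp_epis:
  assumes "category C" "f \<in> epis C A B" "g \<in> epis C B D"
  shows "Comp C g f \<in> epis C A D"
  unfolding epis_iff[OF assms(1)]
proof (intro conjI allI ballI impI)
  note hom = assms(2,3)[THEN epis_hom]
  show "Comp C g f \<in> hom_set C A D"
    using Comp_hom assms(1) hom by metis
  fix E u v
  assume u: "u \<in> hom_set C D E" and v: "v \<in> hom_set C D E"
    and eq: "Comp C u (Comp C g f) = Comp C v (Comp C g f)"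
  have "Comp C (Comp C u g) f = Comp C (Comp C v g) f"
    using eq Comp_assoc[OF assms(1) hom] u v by metis
  then have "Comp C u g = Comp C v g"
    using episD[OF assms(1,2)] Comp_hom[OF assms(1) hom(2)] u v by metis
  then show "u = v"
    using episD[OF assms(1,3) u v] by simp
qed

lemma epis_cancel:
  assumes "category C" "f \<in> hom_set C A B" "g \<in> hom_set C B D" "Comp C g f \<in> epis C A D"
  shows "g \<in> epis C B D"
  unfolding epis_iff[OF assms(1)]
proof (intro conjI allI ballI impI assms(3))
  fix E u v
  assume u: "u \<in> hom_set C D E" and v: "v \<in> hom_set C D E" and eq: "Comp C u g = Comp C v g"
  have "Comp C u (Comp C g f) = Comp C v (Comp C g f)"
    using eq Comp_assoc[OF assms(1-3)] u v by metis
  then show "u = v"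
    using episD[OF assms(1,4) u v] by simp
qed

lemma isomorphism_relE:
  assumes "(A, B) \<in> isomorphism_rel C"
  obtains f g where "f \<in> hom_set C A B" "g \<in> hom_set C B A"
    "Comp C g f = Ident C A" "Comp C f g = Ident C B"
  using assms unfolding isomorphism_rel_def is_iso_def
  by (smt (verit) case_prodD hom_setD mem_Collect_eq)

lemma isomorphism_relI:
  assumes "category C" "f \<in> hom_set C A B" "g \<in> hom_set C B A"
    "Comp C g f = Ident C A" "Comp C f g = Ident C B"
  shows "(A, B) \<in> isomorphism_rel C"
  using assms hom_set_Ob[OF assms(1,2)] hom_setD[OF assms(2)]
  unfolding isomorphism_rel_def is_iso_def by auto

text \<open>A split epimorphism: the composite with the section \<open>g\<close> is an identity,
  hence epi, and the outer factor of an epimorphism is epi.\<close>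

lemma iso_epis:
  assumes "category C" "f \<in> hom_set C A B" "g \<in> hom_set C B A" "Comp C f g = Ident C B"
  shows "f \<in> epis C A B"
proof (rule epis_cancel[OF assms(1,3,2)])
  have B: "B \<in> Ob C" using hom_set_Ob[OF assms(1,2)] by simp
  show "Comp C f g \<in> epis C B B"
    unfolding assms(4) epis_iff[OF assms(1)]
    using Ident_hom[OF assms(1) B] Comp_Ident[OF assms(1)] by metis
qed

lemma equiv_isomorphism_rel:
  assumes cat: "category C"
  shows "equiv (Ob C) (isomorphism_rel C)"
proof (rule equivI)
  show "isomorphism_rel C \<subseteq> Ob C \<times> Ob C"
    by (auto simp: isomorphism_rel_def)
  show "refl_on (Ob C) (isomorphism_rel C)"
  proof (rule refl_onI)
    fix A assume "A \<in> Ob C"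
    note I = Ident_hom[OF cat this]
    show "(A, A) \<in> isomorphism_rel C"
      by (rule isomorphism_relI[OF cat I I Comp_Ident(1)[OF cat I] Comp_Ident(1)[OF cat I]])
  qed
  show "sym (isomorphism_rel C)"
  proof (rule symI)
    fix A B assume "(A, B) \<in> isomorphism_rel C"
    then show "(B, A) \<in> isomorphism_rel C"
      by (rule isomorphism_relE) (rule isomorphism_relI[OF cat])
  qed
  show "trans (isomorphism_rel C)"
  proof (rule transI)
    fix A B D assume "(A, B) \<in> isomorphism_rel C" "(B, D) \<in> isomorphism_rel C"
    then obtain f g f' g' where f: "f \<in> hom_set C A B" and g: "g \<in> hom_set C B A"
      and gf: "Comp C g f = Ident C A" "Comp C f g = Ident C B"
      and f': "f' \<in> hom_set C B D" and g': "g' \<in> hom_set C D B"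
      and gf': "Comp C g' f' = Ident C B" "Comp C f' g' = Ident C D"
      by (elim isomorphism_relE) blast
    note h = Comp_hom[OF cat]
    have "Comp C (Comp C g g') (Comp C f' f) = Comp C g (Comp C (Comp C g' f') f)"
      by (simp only: Comp_assoc[OF cat h[OF f f'] g' g, symmetric] Comp_assoc[OF cat f f' g'])
    also have "\<dots> = Ident C A"
      using gf gf' Comp_Ident[OF cat f] by simp
    finally have 1: "Comp C (Comp C g g') (Comp C f' f) = Ident C A" .
    have "Comp C (Comp C f' f) (Comp C g g') = Comp C f' (Comp C (Comp C f g) g')"
      by (simp only: Comp_assoc[OF cat h[OF g' g] f f', symmetric] Comp_assoc[OF cat g' g f])
    also have "\<dots> = Ident C D"
      using gf gf' Comp_Ident[OF cat g'] by simp
    finally have 2: "Comp C (Comp C f' f) (Comp C g g') = Ident C D" .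
    show "(A, D) \<in> isomorphism_rel C"
      by (rule isomorphism_relI[OF cat h[OF f f'] h[OF g' g] 1 2])
  qed
qed

text \<open>Composition with the two mutually inverse arrows gives inverse bijections. Applied in
  \<open>Pro C\<close>, this and its counterpart for codomains make the epimorphism count an
  invariant of isomorphism classes.\<close>

lemma card_epis_iso_dom:
  assumes cat: "category C" and "(A, B) \<in> isomorphism_rel C"
  shows "card (epis C A G) = card (epis C B G)"
proof -
  obtain f g where f: "f \<in> hom_set C A B" and g: "g \<in> hom_set C B A"
    and gf: "Comp C g f = Ident C A" "Comp C f g = Ident C B"
    using assms(2) by (rule isomorphism_relE)
  note ef = iso_epis[OF cat f g gf(2)] and eg = iso_epis[OF cat g f gf(1)]
  have "bij_betw (\<lambda>h. Comp C h g) (epis C A G) (epis C B G)"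
  proof (rule bij_betw_byWitness[where f' = "\<lambda>h. Comp C h f"])
    show "\<forall>h\<in>epis C A G. Comp C (Comp C h g) f = h"
      using Comp_assoc[OF cat f g] Comp_Ident[OF cat] epis_hom gf by metis
    show "\<forall>h\<in>epis C B G. Comp C (Comp C h f) g = h"
      using Comp_assoc[OF cat g f] Comp_Ident[OF cat] epis_hom gf by metis
  qed (use Comp_epis[OF cat] ef eg in auto)
  then show ?thesis by (rule bij_betw_same_card)
qed

lemma card_epis_iso_cod:
  assumes cat: "category C" and "(A, B) \<in> isomorphism_rel C"
  shows "card (epis C X A) = card (epis C X B)"
proof -
  obtain f g where f: "f \<in> hom_set C A B" and g: "g \<in> hom_set C B A"
    and gf: "Comp C g f = Ident C A" "Comp C f g = Ident C B"
    using assms(2) by (rule isomorphism_relE)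
  note ef = iso_epis[OF cat f g gf(2)] and eg = iso_epis[OF cat g f gf(1)]
  have "bij_betw (\<lambda>h. Comp C f h) (epis C X A) (epis C X B)"
  proof (rule bij_betw_byWitness[where f' = "\<lambda>h. Comp C g h"])
    show "\<forall>h\<in>epis C X A. Comp C g (Comp C f h) = h"
      using Comp_assoc[OF cat _ f g] Comp_Ident[OF cat] epis_hom gf by metis
    show "\<forall>h\<in>epis C X B. Comp C f (Comp C g h) = h"
      using Comp_assoc[OF cat _ g f] Comp_Ident[OF cat] epis_hom gf by metis
  qed (use Comp_epis[OF cat] ef eg in auto)
  then show ?thesis by (rule bij_betw_same_card)
qed

section \<open>The category of pro-objects\<close>

lemma pro_objectD:
  assumes "pro_object C X"
  shows "category (Idx X)" "cofiltered (Idx X)"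
    and "i \<in> Ob (Idx X) \<Longrightarrow> PObj X i \<in> Ob C"
    and "i \<in> Ob (Idx X) \<Longrightarrow> PArr X (Ident (Idx X) i) = Ident C (PObj X i)"
    and "u \<in> hom_set (Idx X) i j \<Longrightarrow> PArr X u \<in> hom_set C (PObj X i) (PObj X j)"
    and "u \<in> hom_set (Idx X) i j \<Longrightarrow> v \<in> hom_set (Idx X) j k \<Longrightarrow>
      PArr X (Comp (Idx X) v u) = Comp C (PArr X v) (PArr X u)"
  using assms by (auto simp: pro_object_def cofiltered_def hom_set_def)

section \<open>Arrows from a pro-object to an object of the base category\<close>

lemma colim_reps_iff:
  "(i, f) \<in> colim_reps C X G \<longleftrightarrow> i \<in> Ob (Idx X) \<and> f \<in> hom_set C (PObj X i) G"
  by (simp add: colim_reps_def)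

lemma colim_relI:
  assumes "category C" "pro_object C X"
    "f \<in> hom_set C (PObj X i) G" "g \<in> hom_set C (PObj X j) G"
    "u \<in> hom_set (Idx X) k i" "v \<in> hom_set (Idx X) k j"
    "Comp C f (PArr X u) = Comp C g (PArr X v)"
  shows "((i, f), (j, g)) \<in> colim_rel C X G"
  using assms hom_set_Ob[OF pro_objectD(1)[OF assms(2)]]
  unfolding colim_rel_def by (auto simp: colim_reps_iff)

lemma colim_relE:
  assumes "((i, f), (j, g)) \<in> colim_rel C X G"
  obtains k u v where "i \<in> Ob (Idx X)" "j \<in> Ob (Idx X)"
    "f \<in> hom_set C (PObj X i) G" "g \<in> hom_set C (PObj X j) G"
    "u \<in> hom_set (Idx X) k i" "v \<in> hom_set (Idx X) k j"
    "Comp C f (PArr X u) = Comp C g (PArr X v)"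
  using assms unfolding colim_rel_def by (auto simp: colim_reps_iff)

text \<open>Transitivity is where cofilteredness enters, through both of its clauses: two witnessing
  stages are first dominated by a common one, and then the two resulting paths to the middle index
  are equalized.\<close>

lemma equiv_colim_rel:
  assumes cat: "category C" and X: "pro_object C X"
  shows "equiv (colim_reps C X G) (colim_rel C X G)"
proof (rule equivI)
  note P = pro_objectD[OF X]
  show "colim_rel C X G \<subseteq> colim_reps C X G \<times> colim_reps C X G"
    by (auto simp: colim_rel_def)
  show "refl_on (colim_reps C X G) (colim_rel C X G)"
  proof (rule refl_onI)
    fix a assume "a \<in> colim_reps C X G"
    then obtain i f where a: "a = (i, f)" "i \<in> Ob (Idx X)" "f \<in> hom_set C (PObj X i) G"
      by (auto simp: colim_reps_def)
    show "(a, a) \<in> colim_rel C X G"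
      unfolding a(1) by (rule colim_relI[OF cat X a(3,3) Ident_hom[OF P(1) a(2)] Ident_hom[OF P(1) a(2)] refl])
  qed
  show "sym (colim_rel C X G)"
  proof (rule symI)
    fix a b assume ab: "(a, b) \<in> colim_rel C X G"
    obtain i f j g where a: "a = (i, f)" and b: "b = (j, g)"
      by (metis surj_pair)
    show "(b, a) \<in> colim_rel C X G"
      using ab unfolding a b
      by (rule colim_relE) (rule colim_relI[OF cat X], assumption+, rule sym)
  qed
  show "trans (colim_rel C X G)"
  proof (rule transI)
    fix a b c assume ab: "(a, b) \<in> colim_rel C X G" and bc: "(b, c) \<in> colim_rel C X G"
    obtain i f j g l h where a: "a = (i, f)" and b: "b = (j, g)" and c: "c = (l, h)"
      by (metis surj_pair)
    obtain k u v where f: "f \<in> hom_set C (PObj X i) G" and g: "g \<in> hom_set C (PObj X j) G"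
      and u: "u \<in> hom_set (Idx X) k i" and v: "v \<in> hom_set (Idx X) k j"
      and uv: "Comp C f (PArr X u) = Comp C g (PArr X v)"
      using ab unfolding a b by (elim colim_relE)
    obtain k' u' v' where h: "h \<in> hom_set C (PObj X l) G"
      and u': "u' \<in> hom_set (Idx X) k' j" and v': "v' \<in> hom_set (Idx X) k' l"
      and uv': "Comp C g (PArr X u') = Comp C h (PArr X v')"
      using bc unfolding b c by (elim colim_relE)
    have "k \<in> Ob (Idx X)" "k' \<in> Ob (Idx X)"
      using hom_set_Ob[OF P(1)] u u' by auto
    \<comment> \<open>\<open>m\<close> lies over both witnessing stages \<open>k\<close> and
      \<open>k'\<close>.\<close>
    then obtain m w w' where w: "w \<in> hom_set (Idx X) m k" and w': "w' \<in> hom_set (Idx X) m k'"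
      using P(2) unfolding cofiltered_def by blast
    note ch = Comp_hom[OF P(1)]
    have vw: "Comp (Idx X) v w \<in> hom_set (Idx X) m j" "Comp (Idx X) u' w' \<in> hom_set (Idx X) m j"
      using ch w w' v u' by blast+
    moreover have "m \<in> Ob (Idx X)" "j \<in> Ob (Idx X)"
      using hom_set_Ob[OF P(1)] vw by auto
    \<comment> \<open>The paths from \<open>m\<close> to \<open>j\<close> through \<open>k\<close>
      and through \<open>k'\<close> may differ; \<open>z\<close> equalizes them, so the two given
      equations can be chained at stage \<open>n\<close>.\<close>
    ultimately obtain n z where z: "z \<in> hom_set (Idx X) n m"
      and eq: "Comp (Idx X) (Comp (Idx X) v w) z = Comp (Idx X) (Comp (Idx X) u' w') z"
      using P(2) unfolding cofiltered_def by blast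
    note wz = ch[OF z w] and wz' = ch[OF z w']
    have push: "Comp C p (PArr X (Comp (Idx X) r s)) = Comp C (Comp C p (PArr X r)) (PArr X s)"
      if "p \<in> hom_set C (PObj X x) G" "r \<in> hom_set (Idx X) y x" "s \<in> hom_set (Idx X) t y"
      for p r s x y t
      using Comp_assoc[OF cat P(5)[OF that(3)] P(5)[OF that(2)] that(1)] P(6)[OF that(3,2)]
      by simp
    have "Comp C f (PArr X (Comp (Idx X) u (Comp (Idx X) w z)))
        = Comp C g (PArr X (Comp (Idx X) v (Comp (Idx X) w z)))"
      using push[OF f u wz] push[OF g v wz] uv by simp
    also have "Comp (Idx X) v (Comp (Idx X) w z) = Comp (Idx X) u' (Comp (Idx X) w' z)"
      using eq Comp_assoc[OF P(1) z w v] Comp_assoc[OF P(1) z w' u'] by simp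
    also have "Comp C g (PArr X (Comp (Idx X) u' (Comp (Idx X) w' z)))
        = Comp C h (PArr X (Comp (Idx X) v' (Comp (Idx X) w' z)))"
      using push[OF g u' wz'] push[OF h v' wz'] uv' by simp
    finally show "(a, c) \<in> colim_rel C X G"
      unfolding a c by (rule colim_relI[OF cat X f h ch[OF wz u] ch[OF wz' v']])
  qed
qed

text \<open>The arrow from \<open>X\<close> to \<open>G\<close> represented by \<open>f\<close> at
  stage \<open>i\<close>. All computations in the colimit are done on such representatives.\<close>

definition colim_class :: "('o, 'a) cat \<Rightarrow> ('i, 'j, 'o, 'a) pro \<Rightarrow> 'o \<Rightarrow> 'i \<Rightarrow> 'a \<Rightarrow> ('i \<times> 'a) set" where
  "colim_class C X G i f = colim_rel C X G `` {(i, f)}"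

lemma colim_class_in:
  "i \<in> Ob (Idx X) \<Longrightarrow> f \<in> hom_set C (PObj X i) G \<Longrightarrow> colim_class C X G i f \<in> colim_hom C X G"
  unfolding colim_class_def colim_hom_def by (rule quotientI) (simp add: colim_reps_iff)

lemma colim_homE:
  assumes "c \<in> colim_hom C X G"
  obtains i f where "i \<in> Ob (Idx X)" "f \<in> hom_set C (PObj X i) G" "c = colim_class C X G i f"
proof -
  obtain x where x: "x \<in> colim_reps C X G" "c = colim_rel C X G `` {x}"
    using assms unfolding colim_hom_def by (elim quotientE)
  show ?thesis
    by (rule that[of "fst x" "snd x"]) (use x in \<open>auto simp: colim_reps_def colim_class_def\<close>)
qed

lemma colim_class_eqI:
  assumes "category C" "pro_object C X"
    "f \<in> hom_set C (PObj X i) G" "g \<in> hom_set C (PObj X j) G"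
    "u \<in> hom_set (Idx X) k i" "v \<in> hom_set (Idx X) k j"
    "Comp C f (PArr X u) = Comp C g (PArr X v)"
  shows "colim_class C X G i f = colim_class C X G j g"
  unfolding colim_class_def
  by (rule equiv_class_eq[OF equiv_colim_rel[OF assms(1,2)] colim_relI[OF assms]])

text \<open>Moving a representative along a transition arrow does not change its class; the common
  stage is \<open>k\<close> itself, with the identity as one leg.\<close>

lemma colim_class_precomp:
  assumes "category C" "pro_object C X" "f \<in> hom_set C (PObj X i) G" "u \<in> hom_set (Idx X) k i"
  shows "colim_class C X G k (Comp C f (PArr X u)) = colim_class C X G i f"
proof -
  note P = pro_objectD[OF assms(2)]
  have k: "k \<in> Ob (Idx X)"
    using hom_set_Ob[OF P(1) assms(4)] by simp
  have fu: "Comp C f (PArr X u) \<in> hom_set C (PObj X k) G"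
    using Comp_hom[OF assms(1) P(5)[OF assms(4)] assms(3)] .
  show ?thesis
    by (rule colim_class_eqI[OF assms(1,2) fu assms(3) Ident_hom[OF P(1) k] assms(4)])
      (use P(4)[OF k] Comp_Ident[OF assms(1) fu] in simp)
qed

text \<open>\<open>postcomp\<close> acts on all representatives of a class at once. By associativity
  an equation witnessing that two representatives agree survives composition with \<open>h\<close>,
  so the union runs over equal classes and one representative determines it.\<close>

lemma postcomp_class:
  assumes cat: "category C" and X: "pro_object C X" and i: "i \<in> Ob (Idx X)"
    and f: "f \<in> hom_set C (PObj X i) G" and h: "h \<in> hom_set C G H"
  shows "postcomp C X h (colim_class C X G i f) = colim_class C X H i (Comp C h f)"
proof -
  have eq: "colim_class C X H j (Comp C h g) = colim_class C X H i (Comp C h f)"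
    if jg: "(j, g) \<in> colim_class C X G i f" for j g
  proof -
    from jg have "((i, f), (j, g)) \<in> colim_rel C X G"
      by (simp add: colim_class_def)
    then obtain k u v where g: "g \<in> hom_set C (PObj X j) G"
      and u: "u \<in> hom_set (Idx X) k i" and v: "v \<in> hom_set (Idx X) k j"
      and uv: "Comp C f (PArr X u) = Comp C g (PArr X v)"
      by (elim colim_relE)
    have "Comp C (Comp C h f) (PArr X u) = Comp C (Comp C h g) (PArr X v)"
      using uv Comp_assoc[OF cat pro_objectD(5)[OF X u] f h]
        Comp_assoc[OF cat pro_objectD(5)[OF X v] g h] by simp
    then show ?thesis
      using colim_class_eqI[OF cat X Comp_hom[OF cat f h] Comp_hom[OF cat g h] u v] by simp
  qed
  have self: "(i, f) \<in> colim_class C X G i f"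
    unfolding colim_class_def using i f
    by (intro equiv_class_self[OF equiv_colim_rel[OF cat X]]) (simp add: colim_reps_iff)
  let ?A = "colim_class C X G i f"
  have "{(j, Comp C h g) | j g. (j, g) \<in> ?A} = (\<lambda>x. (fst x, Comp C h (snd x))) ` ?A"
    by force
  then have "postcomp C X h ?A = (\<Union>x\<in>?A. colim_class C X H (fst x) (Comp C h (snd x)))"
    unfolding postcomp_def hom_setD(3)[OF h] colim_class_def
    by (simp only: Image_eq_UN[of _ "_ ` _"] image_image)
  also have "\<dots> = colim_class C X H i (Comp C h f)"
  proof (rule SUP_eq_const)
    show "colim_class C X H (fst x) (Comp C h (snd x)) = colim_class C X H i (Comp C h f)"
      if "x \<in> ?A" for x
      by (rule eq) (use that in simp)
  qed (use self in auto)
  finally show ?thesis .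
qed

lemma postcomp_in:
  assumes "category C" "pro_object C X" "c \<in> colim_hom C X G" "h \<in> hom_set C G H"
  shows "postcomp C X h c \<in> colim_hom C X H"
  using assms
  by (elim colim_homE) (simp add: postcomp_class colim_class_in Comp_hom)

lemma postcomp_postcomp:
  assumes "category C" "pro_object C X" "c \<in> colim_hom C X G"
    "h \<in> hom_set C G H" "k \<in> hom_set C H K"
  shows "postcomp C X k (postcomp C X h c) = postcomp C X (Comp C k h) c"
  using assms(3)
proof (rule colim_homE)
  fix i f assume i: "i \<in> Ob (Idx X)" and f: "f \<in> hom_set C (PObj X i) G"
    and c: "c = colim_class C X G i f"
  show ?thesis
    unfolding c postcomp_class[OF assms(1,2) i f assms(4)]
      postcomp_class[OF assms(1,2) i Comp_hom[OF assms(1) f assms(4)] assms(5)]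
      postcomp_class[OF assms(1,2) i f Comp_hom[OF assms(1) assms(4,5)]]
    using Comp_assoc[OF assms(1) f assms(4,5)] by simp
qed

lemma postcomp_Ident:
  assumes "category C" "pro_object C X" "c \<in> colim_hom C X G" "G \<in> Ob C"
  shows "postcomp C X (Ident C G) c = c"
  using assms(3)
proof (rule colim_homE)
  fix i f assume i: "i \<in> Ob (Idx X)" and f: "f \<in> hom_set C (PObj X i) G"
    and c: "c = colim_class C X G i f"
  show ?thesis
    unfolding c postcomp_class[OF assms(1,2) i f Ident_hom[OF assms(1,4)]]
    using Comp_Ident[OF assms(1) f] by simp
qed

section \<open>Arrows of pro-objects and their composition\<close>

lemma pro_homD:
  assumes "\<phi> \<in> pro_hom C X Y"
  shows "\<phi> \<in> extensional (Ob (Idx Y))"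
    and "k \<in> Ob (Idx Y) \<Longrightarrow> \<phi> k \<in> colim_hom C X (PObj Y k)"
    and "w \<in> hom_set (Idx Y) k l \<Longrightarrow> postcomp C X (PArr Y w) (\<phi> k) = \<phi> l"
  using assms by (auto simp: pro_hom_def PiE_def hom_set_def)

lemma pro_homI:
  assumes "\<phi> \<in> extensional (Ob (Idx Y))"
    and "\<And>k. k \<in> Ob (Idx Y) \<Longrightarrow> \<phi> k \<in> colim_hom C X (PObj Y k)"
    and "\<And>w k l. w \<in> hom_set (Idx Y) k l \<Longrightarrow> postcomp C X (PArr Y w) (\<phi> k) = \<phi> l"
  shows "\<phi> \<in> pro_hom C X Y"
  using assms by (auto simp: pro_hom_def PiE_def hom_set_def)

lemma Pro_hom_set:
  "a \<in> hom_set (Pro C) X Y \<longleftrightarrow>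
     (\<exists>\<phi>. a = (X, Y, \<phi>) \<and> pro_object C X \<and> pro_object C Y \<and> \<phi> \<in> pro_hom C X Y)"
  by (auto simp: hom_set_def Pro_def)

text \<open>Precomposition with the arrow \<open>\<phi>\<close> from \<open>X\<close> to
  \<open>Y\<close>, turning arrows from \<open>Y\<close> to an object of \<open>C\<close> into
  arrows from \<open>X\<close>. It is the union occurring in \<open>pro_comp\<close>, isolated so
  that composition can be studied one component at a time.\<close>

definition colim_act :: "('o, 'a) cat \<Rightarrow> ('i, 'j, 'o, 'a) pro \<Rightarrow> ('i \<Rightarrow> ('i \<times> 'a) set) \<Rightarrow>
    ('i \<times> 'a) set \<Rightarrow> ('i \<times> 'a) set" where
  "colim_act C X \<phi> c = (\<Union>(k, g)\<in>c. postcomp C X g (\<phi> k))"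

text \<open>Independence of the representative is the compatibility of the family
  \<open>\<phi>\<close>: both \<open>\<phi> i\<close> and \<open>\<phi> j\<close> are obtained from
  \<open>\<phi> k\<close> at the common stage, where the two representatives become equal.\<close>

lemma colim_act_class:
  assumes cat: "category C" and X: "pro_object C X" and Y: "pro_object C Y"
    and \<phi>: "\<phi> \<in> pro_hom C X Y" and i: "i \<in> Ob (Idx Y)" and f: "f \<in> hom_set C (PObj Y i) G"
  shows "colim_act C X \<phi> (colim_class C Y G i f) = postcomp C X f (\<phi> i)"
proof -
  have eq: "postcomp C X g (\<phi> j) = postcomp C X f (\<phi> i)"
    if jg: "(j, g) \<in> colim_class C Y G i f" for j g
  proof -
    from jg have "((i, f), (j, g)) \<in> colim_rel C Y G"
      by (simp add: colim_class_def)
    then obtain k u v where g: "g \<in> hom_set C (PObj Y j) G"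
      and u: "u \<in> hom_set (Idx Y) k i" and v: "v \<in> hom_set (Idx Y) k j"
      and uv: "Comp C f (PArr Y u) = Comp C g (PArr Y v)"
      by (elim colim_relE)
    have "k \<in> Ob (Idx Y)"
      using hom_set_Ob[OF pro_objectD(1)[OF Y] u] by simp
    note k = pro_homD(2)[OF \<phi> this]
    show ?thesis
      using postcomp_postcomp[OF cat X k pro_objectD(5)[OF Y v] g]
        postcomp_postcomp[OF cat X k pro_objectD(5)[OF Y u] f] uv
      by (simp add: pro_homD(3)[OF \<phi> u] pro_homD(3)[OF \<phi> v])
  qed
  have self: "(i, f) \<in> colim_class C Y G i f"
    unfolding colim_class_def using i f
    by (intro equiv_class_self[OF equiv_colim_rel[OF cat Y]]) (simp add: colim_reps_iff)
  show ?thesis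
    unfolding colim_act_def
  proof (rule SUP_eq_const)
    show "(case x of (k, g) \<Rightarrow> postcomp C X g (\<phi> k)) = postcomp C X f (\<phi> i)"
      if "x \<in> colim_class C Y G i f" for x
      using that by (cases x) (simp only: prod.case, rule eq)
  qed (use self in auto)
qed

lemma colim_act_in:
  assumes "category C" "pro_object C X" "pro_object C Y" "\<phi> \<in> pro_hom C X Y"
    "c \<in> colim_hom C Y G"
  shows "colim_act C X \<phi> c \<in> colim_hom C X G"
  using assms(5)
proof (rule colim_homE)
  fix i f assume i: "i \<in> Ob (Idx Y)" and f: "f \<in> hom_set C (PObj Y i) G"
    and c: "c = colim_class C Y G i f"
  show ?thesis
    unfolding c colim_act_class[OF assms(1-4) i f]
    by (rule postcomp_in[OF assms(1,2) pro_homD(2)[OF assms(4) i] f])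
qed

text \<open>Precomposition commutes with postcomposition. This naturality gives the compatibility of
  a composed family and is also the content of associativity in \<open>Pro C\<close>.\<close>

lemma colim_act_postcomp:
  assumes "category C" "pro_object C X" "pro_object C Y" "\<phi> \<in> pro_hom C X Y"
    "c \<in> colim_hom C Y G" "h \<in> hom_set C G H"
  shows "colim_act C X \<phi> (postcomp C Y h c) = postcomp C X h (colim_act C X \<phi> c)"
  using assms(5)
proof (rule colim_homE)
  fix i f assume i: "i \<in> Ob (Idx Y)" and f: "f \<in> hom_set C (PObj Y i) G"
    and c: "c = colim_class C Y G i f"
  show ?thesis
    unfolding c postcomp_class[OF assms(1,3) i f assms(6)] colim_act_class[OF assms(1-4) i f]
      colim_act_class[OF assms(1-4) i Comp_hom[OF assms(1) f assms(6)]]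
    using postcomp_postcomp[OF assms(1,2) pro_homD(2)[OF assms(4) i] f assms(6)] by simp
qed

lemma Pro_Comp:
  "Comp (Pro C) (Y', Z, \<psi>) (X, Y, \<phi>) = (X, Z, \<lambda>m\<in>Ob (Idx Z). colim_act C X \<phi> (\<psi> m))"
  by (simp add: Pro_def colim_act_def)

lemma pro_comp_hom:
  assumes "category C" "pro_object C X" "pro_object C Y" "pro_object C Z"
    "\<phi> \<in> pro_hom C X Y" "\<psi> \<in> pro_hom C Y Z"
  shows "(\<lambda>m\<in>Ob (Idx Z). colim_act C X \<phi> (\<psi> m)) \<in> pro_hom C X Z"
proof (rule pro_homI)
  fix w k l assume w: "w \<in> hom_set (Idx Z) k l"
  then have "k \<in> Ob (Idx Z)" "l \<in> Ob (Idx Z)"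
    using hom_set_Ob[OF pro_objectD(1)[OF assms(4)]] by auto
  then show "postcomp C X (PArr Z w) ((\<lambda>m\<in>Ob (Idx Z). colim_act C X \<phi> (\<psi> m)) k)
      = (\<lambda>m\<in>Ob (Idx Z). colim_act C X \<phi> (\<psi> m)) l"
    using colim_act_postcomp[OF assms(1-3,5) pro_homD(2)[OF assms(6)] pro_objectD(5)[OF assms(4) w]]
      pro_homD(3)[OF assms(6) w] by simp
qed (use colim_act_in[OF assms(1-3,5)] pro_homD(2)[OF assms(6)] in auto)

lemma Pro_Ident:
  "Ident (Pro C) X = (X, X, \<lambda>k\<in>Ob (Idx X). colim_class C X (PObj X k) k (Ident C (PObj X k)))"
  by (simp add: Pro_def pro_ident_def colim_class_def)

lemma pro_ident_hom:
  assumes cat: "category C" and X: "pro_object C X"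
  shows "(\<lambda>k\<in>Ob (Idx X). colim_class C X (PObj X k) k (Ident C (PObj X k))) \<in> pro_hom C X X"
proof (rule pro_homI)
  note P = pro_objectD[OF X]
  fix w k l assume w: "w \<in> hom_set (Idx X) k l"
  then have kl: "k \<in> Ob (Idx X)" "l \<in> Ob (Idx X)"
    using hom_set_Ob[OF P(1)] by auto
  note Id = Ident_hom[OF cat P(3)]
  show "postcomp C X (PArr X w) ((\<lambda>k\<in>Ob (Idx X). colim_class C X (PObj X k) k (Ident C (PObj X k))) k)
      = (\<lambda>k\<in>Ob (Idx X). colim_class C X (PObj X k) k (Ident C (PObj X k))) l"
    using postcomp_class[OF cat X kl(1) Id[OF kl(1)] P(5)[OF w]]
      colim_class_precomp[OF cat X Id[OF kl(2)] w] Comp_Ident[OF cat P(5)[OF w]] kl by simp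
qed (simp_all add: colim_class_in Ident_hom[OF cat] pro_objectD(3)[OF X])

text \<open>Needed so that the general facts on epimorphisms and isomorphisms apply to
  \<open>Pro C\<close>. Each law is checked componentwise on a representative of a colimit class;
  extensionality of the families then turns equality of components into equality of arrows.\<close>

lemma category_Pro:
  assumes cat: "category C"
  shows "category (Pro C :: (('i, 'j, 'o, 'a) pro, _) cat)"
proof -
  let ?P = "Pro C :: (('i, 'j, 'o, 'a) pro, ('i, 'j, 'o, 'a) pro_arrow) cat"
  have hom: "Comp ?P b a \<in> hom_set ?P X Z" if "a \<in> hom_set ?P X Y" "b \<in> hom_set ?P Y Z" for a b X Y Z
    using that by (auto simp: Pro_hom_set Pro_Comp pro_comp_hom[OF cat])
  have id: "Ident ?P X \<in> hom_set ?P X X" if "pro_object C X" for X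
    using that pro_ident_hom[OF cat that] by (simp add: Pro_hom_set Pro_Ident)
  have id_right: "Comp ?P a (Ident ?P X) = a" if a: "a \<in> hom_set ?P X Y" for a X Y
  proof -
    from a obtain \<phi> where \<phi>: "a = (X, Y, \<phi>)" "pro_object C X" "pro_object C Y" "\<phi> \<in> pro_hom C X Y"
      by (auto simp: Pro_hom_set)
    let ?i = "\<lambda>k\<in>Ob (Idx X). colim_class C X (PObj X k) k (Ident C (PObj X k))"
    have "colim_act C X ?i (\<phi> m) = \<phi> m" if "m \<in> Ob (Idx Y)" for m
      using pro_homD(2)[OF \<phi>(4) that]
    proof (rule colim_homE)
      fix i f assume i: "i \<in> Ob (Idx X)" and f: "f \<in> hom_set C (PObj X i) (PObj Y m)"
        and c: "\<phi> m = colim_class C X (PObj Y m) i f"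
      show ?thesis
        unfolding c colim_act_class[OF cat \<phi>(2,2) pro_ident_hom[OF cat \<phi>(2)] i f]
        using postcomp_class[OF cat \<phi>(2) i Ident_hom[OF cat pro_objectD(3)[OF \<phi>(2) i]] f] i
          Comp_Ident[OF cat f] by simp
    qed
    then have "(\<lambda>m\<in>Ob (Idx Y). colim_act C X ?i (\<phi> m)) = \<phi>"
      using pro_homD(1)[OF \<phi>(4)] by (intro extensionalityI[of _ "Ob (Idx Y)"]) auto
    then show ?thesis
      unfolding \<phi>(1) by (simp add: Pro_Ident Pro_Comp)
  qed
  have id_left: "Comp ?P (Ident ?P Y) a = a" if a: "a \<in> hom_set ?P X Y" for a X Y
  proof -
    from a obtain \<phi> where \<phi>: "a = (X, Y, \<phi>)" "pro_object C X" "pro_object C Y" "\<phi> \<in> pro_hom C X Y"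
      by (auto simp: Pro_hom_set)
    have "colim_act C X \<phi> (colim_class C Y (PObj Y m) m (Ident C (PObj Y m))) = \<phi> m"
      if m: "m \<in> Ob (Idx Y)" for m
      unfolding colim_act_class[OF cat \<phi>(2-4) m Ident_hom[OF cat pro_objectD(3)[OF \<phi>(3) m]]]
      by (rule postcomp_Ident[OF cat \<phi>(2) pro_homD(2)[OF \<phi>(4) m] pro_objectD(3)[OF \<phi>(3) m]])
    then have "(\<lambda>m\<in>Ob (Idx Y). colim_act C X \<phi>
        ((\<lambda>k\<in>Ob (Idx Y). colim_class C Y (PObj Y k) k (Ident C (PObj Y k))) m)) = \<phi>"
      using pro_homD(1)[OF \<phi>(4)] by (intro extensionalityI[of _ "Ob (Idx Y)"]) auto
    then show ?thesis
      unfolding \<phi>(1) by (simp add: Pro_Ident Pro_Comp)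
  qed
  have assoc: "Comp ?P c (Comp ?P b a) = Comp ?P (Comp ?P c b) a"
    if abc: "a \<in> hom_set ?P X Y" "b \<in> hom_set ?P Y Z" "c \<in> hom_set ?P Z W" for a b c X Y Z W
  proof -
    from abc obtain \<phi> \<psi> \<theta> where a: "a = (X, Y, \<phi>)" and b: "b = (Y, Z, \<psi>)" and c: "c = (Z, W, \<theta>)"
      and X: "pro_object C X" and Y: "pro_object C Y" and Z: "pro_object C Z" and W: "pro_object C W"
      and \<phi>: "\<phi> \<in> pro_hom C X Y" and \<psi>: "\<psi> \<in> pro_hom C Y Z" and \<theta>: "\<theta> \<in> pro_hom C Z W"
      by (auto simp: Pro_hom_set)
    let ?\<psi>\<phi> = "\<lambda>m\<in>Ob (Idx Z). colim_act C X \<phi> (\<psi> m)"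
    have "colim_act C X ?\<psi>\<phi> (\<theta> n) = colim_act C X \<phi> (colim_act C Y \<psi> (\<theta> n))"
      if n: "n \<in> Ob (Idx W)" for n
      using pro_homD(2)[OF \<theta> n]
    proof (rule colim_homE)
      fix i f assume i: "i \<in> Ob (Idx Z)" and f: "f \<in> hom_set C (PObj Z i) (PObj W n)"
        and eq: "\<theta> n = colim_class C Z (PObj W n) i f"
      show ?thesis
        unfolding eq colim_act_class[OF cat Y Z \<psi> i f]
          colim_act_class[OF cat X Z pro_comp_hom[OF cat X Y Z \<phi> \<psi>] i f]
          colim_act_postcomp[OF cat X Y \<phi> pro_homD(2)[OF \<psi> i] f]
        using i by simp
    qed
    then show ?thesis
      unfolding a b c Pro_Comp by (simp cong: restrict_cong)
  qed
  have Ob: "X \<in> Ob ?P \<longleftrightarrow> pro_object C X" for X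
    by (simp add: Pro_def)
  have dc: "Dom ?P a \<in> Ob ?P" "Cod ?P a \<in> Ob ?P" if "a \<in> Arr ?P" for a
    using that by (auto simp: Pro_def)
  have arr: "a \<in> hom_set ?P (Dom ?P a) (Cod ?P a)" if "a \<in> Arr ?P" for a
    using that by (simp add: hom_set_def)
  show ?thesis
    unfolding category_def
  proof (intro conjI ballI impI)
    fix f g h assume f: "f \<in> Arr ?P" and g: "g \<in> Arr ?P" and h: "h \<in> Arr ?P"
      and gf: "Dom ?P g = Cod ?P f" and hg: "Dom ?P h = Cod ?P g"
    show "Comp ?P h (Comp ?P g f) = Comp ?P (Comp ?P h g) f"
      by (rule assoc[OF arr[OF f] arr[OF g, unfolded gf] arr[OF h, unfolded hg]])
  next
    fix f g assume f: "f \<in> Arr ?P" and g: "g \<in> Arr ?P" and gf: "Dom ?P g = Cod ?P f"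
    show "Comp ?P g f \<in> hom_set ?P (Dom ?P f) (Cod ?P g)"
      by (rule hom[OF arr[OF f] arr[OF g, unfolded gf]])
  next
    fix f assume f: "f \<in> Arr ?P"
    show "Comp ?P f (Ident ?P (Dom ?P f)) = f" "Comp ?P (Ident ?P (Cod ?P f)) f = f"
      "Dom ?P f \<in> Ob ?P" "Cod ?P f \<in> Ob ?P"
      using id_right id_left arr[OF f] dc[OF f] by blast+
  next
    fix X assume "X \<in> Ob ?P"
    then show "Ident ?P X \<in> hom_set ?P X X"
      using id Ob by blast
  qed
qed

section \<open>The embedding of the base category as constant pro-objects\<close>

lemma const_pro_simps [simp]:
  "Ob (Idx (const_pro C G)) = {undefined}"
  "hom_set (Idx (const_pro C G)) i j = (if i = undefined \<and> j = undefined then {undefined} else {})"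
  "PObj (const_pro C G) i = G"
  "PArr (const_pro C G) u = Ident C G"
  by (auto simp: const_pro_def hom_set_def)

lemma pro_object_const:
  assumes "category C" "G \<in> Ob C"
  shows "pro_object C (const_pro C G)"
  using Ident_hom[OF assms] Comp_Ident(1)[OF assms(1) Ident_hom[OF assms]] assms(2)
  unfolding pro_object_def cofiltered_def category_def const_pro_def hom_set_def by simp

lemma pro_object_constD: "pro_object C (const_pro C G) \<Longrightarrow> G \<in> Ob C"
  using pro_objectD(3)[of C "const_pro C G" undefined] by simp

text \<open>The index category has only an identity arrow, so the colimit identifies nothing and
  every class is a singleton. Full faithfulness of the embedding rests on this.\<close>

lemma colim_class_const:
  assumes "category C" "f \<in> hom_set C A G"
  shows "colim_class C (const_pro C A) G undefined f = {(undefined, f)}"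
proof -
  have "((undefined, f), (j, g)) \<in> colim_rel C (const_pro C A) G \<longleftrightarrow> j = undefined \<and> g = f" for j g
  proof
    assume "((undefined, f), (j, g)) \<in> colim_rel C (const_pro C A) G"
    then have "j = undefined \<and> g \<in> hom_set C A G \<and> Comp C f (Ident C A) = Comp C g (Ident C A)"
      by (rule colim_relE) simp
    then show "j = undefined \<and> g = f"
      using Comp_Ident(1)[OF assms(1), of f A G] Comp_Ident(1)[OF assms(1), of g A G] assms(2) by simp
  next
    assume "j = undefined \<and> g = f"
    moreover have "pro_object C (const_pro C A)"
      by (rule pro_object_const[OF assms(1) hom_set_Ob(1)[OF assms]])
    ultimately show "((undefined, f), (j, g)) \<in> colim_rel C (const_pro C A) G"
      using colim_relI[OF assms(1), of "const_pro C A" f undefined G f undefined undefined undefined undefined]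
        assms(2) by simp
  qed
  then have "x \<in> colim_class C (const_pro C A) G undefined f \<longleftrightarrow> x = (undefined, f)" for x
    by (cases x) (simp add: colim_class_def)
  then show ?thesis
    by blast
qed

text \<open>The embedding on arrows. The family is restricted to the single index because members of
  \<open>pro_hom\<close> are extensional functions.\<close>

definition const_arr :: "('o, 'a) cat \<Rightarrow> 'a \<Rightarrow> ('i, 'j, 'o, 'a) pro_arrow" where
  "const_arr C f =
     (const_pro C (Dom C f), const_pro C (Cod C f), \<lambda>_\<in>{undefined}. {(undefined, f)})"

lemma const_arr_eq_iff:
  "(const_arr C f :: ('i, 'j, 'o, 'a) pro_arrow) = const_arr C g \<longleftrightarrow> f = g"
proof
  assume "(const_arr C f :: ('i, 'j, 'o, 'a) pro_arrow) = const_arr C g"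
  then have "snd (snd (const_arr C f :: ('i, 'j, 'o, 'a) pro_arrow)) undefined
      = snd (snd (const_arr C g :: ('i, 'j, 'o, 'a) pro_arrow)) undefined"
    by simp
  then show "f = g"
    by (simp add: const_arr_def)
qed simp

lemma const_arr_hom:
  fixes C :: "('o, 'a) cat"
  assumes "category C" "f \<in> hom_set C A B"
  shows "(const_arr C f :: ('i, 'j, 'o, 'a) pro_arrow) \<in> hom_set (Pro C) (const_pro C A) (const_pro C B)"
proof -
  let ?A = "const_pro C A :: ('i, 'j, 'o, 'a) pro" and ?B = "const_pro C B :: ('i, 'j, 'o, 'a) pro"
  note AB = hom_set_Ob[OF assms]
  have cin: "{(undefined, f)} \<in> colim_hom C ?A B"
    using colim_class_in[of undefined ?A f C B] assms(2)
    by (simp add: colim_class_const[OF assms])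
  have "postcomp C ?A (Ident C B) {(undefined, f)} = {(undefined, f)}"
    by (rule postcomp_Ident[OF assms(1) pro_object_const[OF assms(1) AB(1)] cin AB(2)])
  then have "(\<lambda>_\<in>{undefined}. {(undefined, f)}) \<in> pro_hom C ?A ?B"
    by (intro pro_homI) (use cin in \<open>simp_all split: if_split_asm\<close>)
  then show ?thesis
    using hom_setD[OF assms(2)] AB
    by (simp add: const_arr_def Pro_hom_set pro_object_const[OF assms(1)])
qed

lemma const_arr_surj:
  fixes a :: "('i, 'j, 'o, 'a) pro_arrow"
  assumes "category C" "a \<in> hom_set (Pro C) (const_pro C A) (const_pro C B)"
  obtains f where "f \<in> hom_set C A B" "a = const_arr C f"
proof -
  let ?A = "const_pro C A :: ('i, 'j, 'o, 'a) pro" and ?B = "const_pro C B :: ('i, 'j, 'o, 'a) pro"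
  obtain \<phi> where a: "a = (?A, ?B, \<phi>)" and \<phi>: "\<phi> \<in> pro_hom C ?A ?B"
    using assms(2) unfolding Pro_hom_set by blast
  have "\<phi> undefined \<in> colim_hom C ?A B"
    using pro_homD(2)[OF \<phi>, of undefined] by simp
  then obtain i f where i: "i \<in> Ob (Idx ?A)" and f': "f \<in> hom_set C (PObj ?A i) B"
    and \<phi>f: "\<phi> undefined = colim_class C ?A B i f"
    by (rule colim_homE)
  have f: "f \<in> hom_set C A B"
    using f' by simp
  have "\<phi> undefined = {(undefined, f)}"
    using \<phi>f i by (simp add: colim_class_const[OF assms(1) f])
  moreover have "\<phi> \<in> extensional {undefined}"
    using pro_homD(1)[OF \<phi>] by simp
  ultimately have "\<phi> = (\<lambda>_\<in>{undefined}. {(undefined, f)})"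
    by (intro extensionalityI[of _ "{undefined}"]) simp_all
  then show ?thesis
    using that[OF f] hom_setD[OF f] by (simp add: a const_arr_def)
qed

lemma colim_act_const:
  assumes cat: "category C" and f: "f \<in> hom_set C A B" and g: "g \<in> hom_set C B G"
  shows "colim_act C (const_pro C A) (\<lambda>_\<in>{undefined}. {(undefined, f)}) {(undefined, g)}
    = {(undefined, Comp C g f)}"
  using postcomp_class[OF cat pro_object_const[OF cat hom_set_Ob(1)[OF cat f]], of undefined f B g G]
    f g by (simp add: colim_act_def colim_class_const[OF cat f] colim_class_const[OF cat Comp_hom[OF cat f g]])

lemma const_arr_Comp:
  fixes C :: "('o, 'a) cat"
  assumes cat: "category C" and f: "f \<in> hom_set C A B" and g: "g \<in> hom_set C B D"
  shows "Comp (Pro C) (const_arr C g) (const_arr C f)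
    = (const_arr C (Comp C g f) :: ('i, 'j, 'o, 'a) pro_arrow)"
  using hom_setD[OF f] hom_setD[OF g] hom_setD[OF Comp_hom[OF cat f g]]
  by (simp add: const_arr_def Pro_Comp, intro restrict_ext) (simp add: colim_act_const[OF cat f g])

lemma const_arr_Ident:
  assumes "category C" "A \<in> Ob C"
  shows "Ident (Pro C) (const_pro C A) = const_arr C (Ident C A)"
  using hom_setD[OF Ident_hom[OF assms]]
  by (simp add: Pro_Ident const_arr_def colim_class_const[OF assms(1) Ident_hom[OF assms]] cong: restrict_cong)

text \<open>Reflection follows from faithfulness. For preservation the test object \<open>Y\<close>
  is an arbitrary pro-object: an arrow from a constant pro-object to \<open>Y\<close> is a family of
  ordinary arrows of \<open>C\<close>, one for each index of \<open>Y\<close>, so \<open>f\<close>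
  can be cancelled in every component.\<close>

lemma const_arr_epis_iff:
  fixes C :: "('o, 'a) cat"
  assumes cat: "category C" and f: "f \<in> hom_set C A B"
  shows "(const_arr C f :: ('i, 'j, 'o, 'a) pro_arrow) \<in> epis (Pro C) (const_pro C A) (const_pro C B)
    \<longleftrightarrow> f \<in> epis C A B"
    (is "?F \<in> epis ?Pro ?A ?B \<longleftrightarrow> _")
proof
  assume epi: "?F \<in> epis ?Pro ?A ?B"
  have "g = h" if g: "g \<in> hom_set C B D" and h: "h \<in> hom_set C B D"
    and eq: "Comp C g f = Comp C h f" for D g h
  proof -
    have "(const_arr C g :: ('i, 'j, 'o, 'a) pro_arrow) = const_arr C h"
      by (rule episD[OF category_Pro[OF cat] epi const_arr_hom[OF cat g] const_arr_hom[OF cat h]])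
        (simp add: const_arr_Comp[OF cat f g] const_arr_Comp[OF cat f h] eq)
    then show ?thesis
      by (simp add: const_arr_eq_iff)
  qed
  then show "f \<in> epis C A B"
    using f unfolding epis_iff[OF cat] by blast
next
  assume epi: "f \<in> epis C A B"
  have "a = b" if a: "a \<in> hom_set ?Pro ?B Y" and b: "b \<in> hom_set ?Pro ?B Y"
    and eq: "Comp ?Pro a ?F = Comp ?Pro b ?F" for a b Y
  proof -
    obtain \<phi> \<psi> where a': "a = (?B, Y, \<phi>)" and b': "b = (?B, Y, \<psi>)"
      and \<phi>: "\<phi> \<in> pro_hom C ?B Y" and \<psi>: "\<psi> \<in> pro_hom C ?B Y"
      using a b unfolding Pro_hom_set by blast
    let ?f = "\<lambda>_\<in>{undefined}. {(undefined :: 'i, f)}"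
    have F: "?F = (?A, ?B, ?f)"
      using hom_setD[OF f] by (simp add: const_arr_def)
    have act: "(\<lambda>m\<in>Ob (Idx Y). colim_act C ?A ?f (\<phi> m)) = (\<lambda>m\<in>Ob (Idx Y). colim_act C ?A ?f (\<psi> m))"
      using eq by (simp add: a' b' F Pro_Comp)
    have "\<phi> m = \<psi> m" if m: "m \<in> Ob (Idx Y)" for m
    proof -
      have singleton: "\<exists>g\<in>hom_set C B (PObj Y m). \<theta> m = {(undefined, g)}"
        if \<theta>: "\<theta> \<in> pro_hom C ?B Y" for \<theta>
        using pro_homD(2)[OF \<theta> m]
      proof (rule colim_homE)
        fix i g assume "i \<in> Ob (Idx ?B)" "g \<in> hom_set C (PObj ?B i) (PObj Y m)"
          "\<theta> m = colim_class C ?B (PObj Y m) i g"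
        then show ?thesis
          by (intro bexI[of _ g]) (simp_all add: colim_class_const[OF cat])
      qed
      obtain g where g: "g \<in> hom_set C B (PObj Y m)" "\<phi> m = {(undefined, g)}"
        using singleton[OF \<phi>] by blast
      obtain h where h: "h \<in> hom_set C B (PObj Y m)" "\<psi> m = {(undefined, h)}"
        using singleton[OF \<psi>] by blast
      have "colim_act C ?A ?f (\<phi> m) = colim_act C ?A ?f (\<psi> m)"
        using fun_cong[OF act, of m] m by simp
      then have "Comp C g f = Comp C h f"
        by (simp add: g(2) h(2) colim_act_const[OF cat f g(1)] colim_act_const[OF cat f h(1)])
      then show ?thesis
        using episD[OF cat epi g(1) h(1)] g(2) h(2) by simp
    qed
    then have "\<phi> = \<psi>"
      using pro_homD(1)[OF \<phi>] pro_homD(1)[OF \<psi>] by (intro extensionalityI[of _ "Ob (Idx Y)"])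
    then show ?thesis
      by (simp add: a' b')
  qed
  then show "?F \<in> epis ?Pro ?A ?B"
    using const_arr_hom[OF cat f] unfolding epis_iff[OF category_Pro[OF cat]] by blast
qed

lemma const_pro_iso:
  assumes cat: "category C" and "(A, B) \<in> isomorphism_rel C"
  shows "(const_pro C A :: ('i, 'j, 'o, 'a) pro, const_pro C B) \<in> isomorphism_rel (Pro C)"
proof -
  obtain f g where f: "f \<in> hom_set C A B" and g: "g \<in> hom_set C B A"
    and gf: "Comp C g f = Ident C A" "Comp C f g = Ident C B"
    using assms(2) by (rule isomorphism_relE)
  show ?thesis
    by (rule isomorphism_relI[OF category_Pro[OF cat] const_arr_hom[OF cat f] const_arr_hom[OF cat g]])
      (simp_all add: const_arr_Comp[OF cat f g] const_arr_Comp[OF cat g f] gf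
        const_arr_Ident[OF cat] hom_set_Ob[OF cat f])
qed

section \<open>Epimorphism counts and level quotients\<close>

text \<open>The quotient arrow has target \<open>const_pro C F\<close>, which must itself be a
  pro-object; its only component is \<open>F\<close>.\<close>

lemma level_quotient_Ob:
  "is_level_quotient C W X F \<Longrightarrow> F \<in> Ob C"
  unfolding is_level_quotient_def pro_epis_def
  by (auto dest!: epis_hom simp: Pro_hom_set pro_object_constD)

text \<open>The bijection is composition with the quotient arrow \<open>q\<close>. Injectivity is
  cancellation of \<open>q\<close> together with faithfulness of the embedding; surjectivity is
  maximality of \<open>F\<close> together with fullness.\<close>

lemma card_pro_epis_level_quotient:
  assumes cat: "category C" and F: "is_level_quotient C W X F" and G: "G \<in> W"
  shows "card (pro_epis C X G) = card (epis C F G)"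
proof -
  note catP = category_Pro[OF cat]
  obtain q where q: "q \<in> epis (Pro C) X (const_pro C F)"
    and fac: "\<And>p. p \<in> epis (Pro C) X (const_pro C G) \<Longrightarrow>
      \<exists>h\<in>hom_set (Pro C) (const_pro C F) (const_pro C G). p = Comp (Pro C) h q"
    using F G unfolding is_level_quotient_def pro_epis_def by blast
  have "bij_betw (\<lambda>h. Comp (Pro C) (const_arr C h) q) (epis C F G) (pro_epis C X G)"
    unfolding bij_betw_def
  proof
    show "inj_on (\<lambda>h. Comp (Pro C) (const_arr C h) q) (epis C F G)"
    proof (rule inj_onI)
      fix h h' assume h: "h \<in> epis C F G" and h': "h' \<in> epis C F G"
        and eq: "Comp (Pro C) (const_arr C h) q = Comp (Pro C) (const_arr C h') q"
      show "h = h'"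
        using episD[OF catP q const_arr_hom[OF cat epis_hom[OF h]] const_arr_hom[OF cat epis_hom[OF h']] eq]
        by (simp add: const_arr_eq_iff)
    qed
    show "(\<lambda>h. Comp (Pro C) (const_arr C h) q) ` epis C F G = pro_epis C X G"
    proof (intro equalityI subsetI)
      fix p assume "p \<in> (\<lambda>h. Comp (Pro C) (const_arr C h) q) ` epis C F G"
      then obtain h where h: "h \<in> epis C F G" and p: "p = Comp (Pro C) (const_arr C h) q"
        by auto
      show "p \<in> pro_epis C X G"
        unfolding p pro_epis_def
        by (rule Comp_epis[OF catP q]) (simp add: const_arr_epis_iff[OF cat epis_hom[OF h]] h)
    next
      fix p assume "p \<in> pro_epis C X G"
      then have p: "p \<in> epis (Pro C) X (const_pro C G)"
        by (simp add: pro_epis_def)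
      then obtain a where a: "a \<in> hom_set (Pro C) (const_pro C F) (const_pro C G)" "p = Comp (Pro C) a q"
        using fac by blast
      obtain h where h: "h \<in> hom_set C F G" "a = const_arr C h"
        using const_arr_surj[OF cat a(1)] .
      have "a \<in> epis (Pro C) (const_pro C F) (const_pro C G)"
        by (rule epis_cancel[OF catP epis_hom[OF q] a(1)]) (use p a(2) in simp)
      then have "h \<in> epis C F G"
        by (simp add: h(2) const_arr_epis_iff[OF cat h(1)])
      then show "p \<in> (\<lambda>h. Comp (Pro C) (const_arr C h) q) ` epis C F G"
        using a(2) h(2) by blast
    qed
  qed
  then show ?thesis
    by (rule bij_betw_same_card[symmetric])
qed

text \<open>The bijection sends \<open>h\<close> to its composites with \<open>p\<close> and
  \<open>q\<close>. These are again epi, hence an admissible test pair, and uniqueness in the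
  universal property gives injectivity. Surjectivity needs the clause that the induced arrow is
  epi.\<close>

lemma card_epis_epi_product:
  assumes cat: "category C" and F: "F \<in> Ob C" and P: "is_epi_product C A B P p q"
  shows "card (epis C F P) = card (epis C F A) * card (epis C F B)"
proof -
  have p: "p \<in> epis C P A" and q: "q \<in> epis C P B"
    and ex: "\<And>a b. a \<in> epis C F A \<Longrightarrow> b \<in> epis C F B \<Longrightarrow>
      \<exists>!h. h \<in> hom_set C F P \<and> Comp C p h = a \<and> Comp C q h = b"
    and epi: "\<And>a b h. a \<in> epis C F A \<Longrightarrow> b \<in> epis C F B \<Longrightarrow> h \<in> hom_set C F P \<Longrightarrow>
      Comp C p h = a \<Longrightarrow> Comp C q h = b \<Longrightarrow> is_epi C h"
    using P F unfolding is_epi_product_def by simp_all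
  have "bij_betw (\<lambda>h. (Comp C p h, Comp C q h)) (epis C F P) (epis C F A \<times> epis C F B)"
    unfolding bij_betw_def
  proof
    show "inj_on (\<lambda>h. (Comp C p h, Comp C q h)) (epis C F P)"
    proof (rule inj_onI)
      fix h h' assume h: "h \<in> epis C F P" and h': "h' \<in> epis C F P"
        and "(Comp C p h, Comp C q h) = (Comp C p h', Comp C q h')"
      then have "Comp C p h = Comp C p h'" "Comp C q h = Comp C q h'"
        by simp_all
      then show "h = h'"
        using ex[OF Comp_epis[OF cat h p] Comp_epis[OF cat h q]] epis_hom[OF h] epis_hom[OF h']
        by (elim ex1E) metis
    qed
    show "(\<lambda>h. (Comp C p h, Comp C q h)) ` epis C F P = epis C F A \<times> epis C F B"
    proof (intro equalityI subsetI)
      fix c assume "c \<in> epis C F A \<times> epis C F B"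
      then obtain a b where c: "c = (a, b)" and a: "a \<in> epis C F A" and b: "b \<in> epis C F B"
        by auto
      obtain h where h: "h \<in> hom_set C F P" "Comp C p h = a" "Comp C q h = b"
        using ex1_implies_ex[OF ex[OF a b]] by blast
      then have "h \<in> epis C F P"
        using epi[OF a b] by (simp add: epis_def)
      then show "c \<in> (\<lambda>h. (Comp C p h, Comp C q h)) ` epis C F P"
        using h c by blast
    qed (use Comp_epis[OF cat] p q in auto)
  qed
  from bij_betw_same_card[OF this] show ?thesis
    by (simp add: card_cartesian_product)
qed

section \<open>Counts on isomorphism classes\<close>

lemma rep_in_quotient:
  assumes "equiv A r" "x \<in> A // r"
  shows "rep x \<in> x"
  unfolding rep_def using in_quotient_imp_non_empty[OF assms] by (auto intro: someI)

lemma equiv_pro_iso: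
  assumes "category C"
  shows "equiv (small_pros C) (isomorphism_rel (Pro C) \<inter> small_pros C \<times> small_pros C)"
proof -
  have "small_pros C \<subseteq> Ob (Pro C)"
    by (auto simp: small_pros_def Pro_def)
  then show ?thesis
    using equiv_isomorphism_rel[OF category_Pro[OF assms]]
    unfolding equiv_def refl_on_def sym_def trans_def by blast
qed

text \<open>Isomorphisms of source and target both preserve the number of epimorphisms; the one
  between targets is first carried from \<open>C\<close> to \<open>Pro C\<close>. Later arguments
  are thereby free of the representatives chosen by \<open>rep\<close>.\<close>

lemma epi_count_eq:
  assumes cat: "category C" and x: "x \<in> pro_iso_classes C" "X \<in> x"
    and c: "c \<in> iso_classes C" "G \<in> c"
  shows "epi_count C x c = card (pro_epis C X G)"
proof -
  note eqP = equiv_pro_iso[OF cat] and eqC = equiv_isomorphism_rel[OF cat]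
  have "(rep x, X) \<in> isomorphism_rel (Pro C)"
    using in_quotient_imp_in_rel[OF eqP] x rep_in_quotient[OF eqP] unfolding pro_iso_classes_def by blast
  moreover have "(rep c, G) \<in> isomorphism_rel C"
    using in_quotient_imp_in_rel[OF eqC] c rep_in_quotient[OF eqC] unfolding iso_classes_def by blast
  ultimately show ?thesis
    unfolding epi_count_def pro_epis_def
    using card_epis_iso_dom[OF category_Pro[OF cat]]
      card_epis_iso_cod[OF category_Pro[OF cat] const_pro_iso[OF cat]] by metis
qed

lemma pro_iso_classes_rep:
  assumes "category C" "x \<in> pro_iso_classes C"
  shows "rep x \<in> x" "rep x \<in> small_pros C"
  using rep_in_quotient[OF equiv_pro_iso] in_quotient_imp_subset[OF equiv_pro_iso] assms
  unfolding pro_iso_classes_def by blast+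

lemma level_contains:
  assumes "finite V" "V \<subseteq> Ob C"
  obtains W where "level C W" "V \<subseteq> W"
  using that[of "\<Inter>{W'. formation C W' \<and> V \<subseteq> W'}"] assms unfolding level_def by blast

lemma epi_count_epi_product:
  assumes cat: "category C" and x: "x \<in> pro_iso_classes C"
    and A: "A \<in> iso_classes C" "G1 \<in> A" and B: "B \<in> iso_classes C" "G2 \<in> B"
    and P: "is_epi_product C G1 G2 P p q"
  shows "epi_count C x (iso_class C P) = epi_count C x A * epi_count C x B"
proof -
  note eqC = equiv_isomorphism_rel[OF cat]
  have Ob: "G1 \<in> Ob C" "G2 \<in> Ob C" "P \<in> Ob C"
    using P hom_set_Ob[OF cat epis_hom] unfolding is_epi_product_def by blast+
  have Pc: "iso_class C P \<in> iso_classes C" "P \<in> iso_class C P"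
    unfolding iso_class_def iso_classes_def
    using quotientI[OF Ob(3)] equiv_class_self[OF eqC Ob(3)] by blast+
  \<comment> \<open>One level containing all three objects, so that the same quotient
    \<open>F\<close> serves for the three counts.\<close>
  obtain W where W: "level C W" "{G1, G2, P} \<subseteq> W"
    by (rule level_contains[of "{G1, G2, P}" C]) (use Ob in auto)
  obtain F where F: "is_level_quotient C W (rep x) F"
    using pro_iso_classes_rep(2)[OF cat x] W(1) unfolding small_pros_def by blast
  show ?thesis
    using epi_count_eq[OF cat x pro_iso_classes_rep(1)[OF cat x]] A B Pc
      card_pro_epis_level_quotient[OF cat F] W(2)
      card_epis_epi_product[OF cat level_quotient_Ob[OF F] P]
    by simp
qed

section \<open>Measurability in the level topology\<close>

lemma openin_level_topology:
  "level C W \<Longrightarrow> F \<in> W \<Longrightarrow>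
    openin (level_topology C) {x \<in> pro_iso_classes C. \<exists>X\<in>x. is_level_quotient C W X F}"
  unfolding level_topology_def by (rule topology_generated_by_Basis) blast

lemma
  shows space_level_borel: "space (level_borel C) = pro_iso_classes C"
    and openin_level_borel: "openin (level_topology C) U \<Longrightarrow> U \<in> sets (level_borel C)"
proof -
  \<comment> \<open>The generators must be subsets of the declared space for \<open>sigma\<close> to
    have the intended space and measurable sets.\<close>
  have "topspace (level_topology C) \<subseteq> pro_iso_classes C"
    unfolding level_topology_def by (auto simp: topology_generated_by_topspace)
  then have sub: "{U. openin (level_topology C) U} \<subseteq> Pow (pro_iso_classes C)"
    using openin_subset by blast
  show "space (level_borel C) = pro_iso_classes C"
    unfolding level_borel_def by (rule space_measure_of[OF sub])
  show "U \<in> sets (level_borel C)" if "openin (level_topology C) U"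
    unfolding level_borel_def sets_measure_of[OF sub] using that by (simp add: sigma_sets.Basic)
qed

lemma measurable_epi_count:
  fixes \<mu> :: "('i, 'j, 'o, 'a) pro set measure"
  assumes cat: "category C" and \<mu>: "sets \<mu> = sets (level_borel C)" and c: "c \<in> iso_classes C"
  shows "(\<lambda>x. epi_count C x c) \<in> measurable \<mu> (count_space UNIV)"
proof -
  have space: "space \<mu> = pro_iso_classes C"
    using sets_eq_imp_space_eq[OF \<mu>] space_level_borel by simp
  note eqC = equiv_isomorphism_rel[OF cat]
  have G: "rep c \<in> c" "rep c \<in> Ob C"
    using rep_in_quotient[OF eqC] in_quotient_imp_subset[OF eqC] c unfolding iso_classes_def by blast+
  obtain W where W: "level C W" "{rep c} \<subseteq> W"
    by (rule level_contains[of "{rep c}" C]) (use G in auto)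
  let ?U = "\<lambda>F. {x :: ('i, 'j, 'o, 'a) pro set. x \<in> pro_iso_classes C \<and> (\<exists>X\<in>x. is_level_quotient C W X F)}"
  have eq: "epi_count C x c = card (epis C F (rep c))" if "x \<in> ?U F" for x F
    using that epi_count_eq[OF cat _ _ c G(1)] card_pro_epis_level_quotient[OF cat] W(2) by fastforce
  have "(\<lambda>x. epi_count C x c) -` {k} \<inter> space \<mu> \<in> sets \<mu>" for k
  proof -
    have "(\<lambda>x. epi_count C x c) -` {k} \<inter> space \<mu> = \<Union>(?U ` {F \<in> W. card (epis C F (rep c)) = k})"
    proof (intro equalityI subsetI)
      fix x assume x: "x \<in> (\<lambda>x. epi_count C x c) -` {k} \<inter> space \<mu>"
      then have "rep x \<in> x" "rep x \<in> small_pros C"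
        using pro_iso_classes_rep[OF cat] space by auto
      moreover from this obtain F where "is_level_quotient C W (rep x) F"
        using W(1) unfolding small_pros_def by blast
      moreover from this have "F \<in> W"
        by (simp add: is_level_quotient_def)
      ultimately have "x \<in> ?U F" "F \<in> W"
        using x space by auto
      then show "x \<in> \<Union>(?U ` {F \<in> W. card (epis C F (rep c)) = k})"
        using eq[of x F] x by auto
    next
      fix x assume "x \<in> \<Union>(?U ` {F \<in> W. card (epis C F (rep c)) = k})"
      then obtain F where "x \<in> ?U F" "card (epis C F (rep c)) = k"
        by blast
      then show "x \<in> (\<lambda>x. epi_count C x c) -` {k} \<inter> space \<mu>"
        using eq[of x F] space by auto
    qed
    \<comment> \<open>The union ranges over objects \<open>F\<close>, possibly uncountably many. It
      is therefore formed inside the topology, and measurability is drawn from openness of the whole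
      fibre.\<close>
    also have "openin (level_topology C) \<dots>"
      by (rule openin_Union) (use openin_level_topology[OF W(1)] in blast)
    finally show ?thesis
      using openin_level_borel \<mu> by blast
  qed
  then show ?thesis
    by (subst measurable_count_space_eq_countable) auto
qed

section \<open>Second moments of weighted sums\<close>

lemma nn_integral_count_space_subset:
  fixes g :: "'a \<Rightarrow> ennreal"
  assumes "T \<subseteq> A"
  shows "(\<integral>\<^sup>+x. g x \<partial>count_space T) = (\<integral>\<^sup>+x. g x * indicator T x \<partial>count_space A)"
  by (subst restrict_count_space_subset[OF assms, symmetric], subst nn_integral_restrict_space)
    (use assms in auto)

text \<open>Both sides are suprema of finite partial sums, over all finite subsets and over the
  initial segments of an enumeration. It gives the sums in the definitions access to the theorems of
  Tonelli and Fubini.\<close>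

lemma infsum_ennreal_eq_nn_integral:
  fixes f :: "'a \<Rightarrow> ennreal"
  assumes "countable A"
  shows "infsum f A = (\<integral>\<^sup>+x. f x \<partial>count_space A)"
proof (cases "finite A")
  case True
  then show ?thesis
    by (simp add: nn_integral_count_space_finite)
next
  case False
  let ?g = "from_nat_into A"
  have g: "bij_betw ?g UNIV A"
    using False assms by (rule bij_betw_from_nat_into[rotated])
  have sup: "infsum f A = (SUP F\<in>{F. finite F \<and> F \<subseteq> A}. sum f F)"
    by (rule nonneg_infsum_complete) simp
  show ?thesis
  proof (rule antisym)
    show "infsum f A \<le> (\<integral>\<^sup>+x. f x \<partial>count_space A)"
      unfolding sup
    proof (rule SUP_least)
      fix F assume F: "F \<in> {F. finite F \<and> F \<subseteq> A}"
      then have "sum f F = (\<integral>\<^sup>+x. f x \<partial>count_space F)"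
        by (simp add: nn_integral_count_space_finite)
      also have "\<dots> = (\<integral>\<^sup>+x. f x * indicator F x \<partial>count_space A)"
        using F by (intro nn_integral_count_space_subset) simp
      also have "\<dots> \<le> (\<integral>\<^sup>+x. f x \<partial>count_space A)"
        by (rule nn_integral_mono) (simp split: split_indicator)
      finally show "sum f F \<le> (\<integral>\<^sup>+x. f x \<partial>count_space A)" .
    qed
    have "(\<integral>\<^sup>+x. f x \<partial>count_space A) = (\<integral>\<^sup>+n. f (?g n) \<partial>count_space UNIV)"
      using g by (rule nn_integral_bij_count_space[symmetric])
    also have "\<dots> = (SUP n. \<Sum>i<n. f (?g i))"
      by (simp add: nn_integral_count_space_nat suminf_eq_SUP)
    also have "\<dots> \<le> infsum f A"
    proof (rule SUP_least)
      fix n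
      have "(\<Sum>i<n. f (?g i)) = sum f (?g ` {..<n})"
        using g by (subst sum.reindex) (auto simp: bij_betw_def intro: inj_on_subset)
      also have "\<dots> \<le> infsum f A"
        unfolding sup using g by (intro SUP_upper) (auto simp: bij_betw_def)
      finally show "(\<Sum>i<n. f (?g i)) \<le> infsum f A" .
    qed
    finally show "(\<integral>\<^sup>+x. f x \<partial>count_space A) \<le> infsum f A" .
  qed
qed

lemma infsum_eq_integral_count_space:
  fixes f :: "'a \<Rightarrow> real"
  assumes "integrable (count_space A) f"
  shows "infsum f A = (\<integral>x. f x \<partial>count_space A)"
  using infsetsum_infsum[of f A] assms by (simp add: abs_summable_on_def infsetsum_def)

text \<open>Absolute convergence lets the square become one sum over pairs, so that a single
  exchange of sum and expectation suffices later.\<close>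

lemma integral_count_space_square:
  fixes d :: "'a \<Rightarrow> real"
  assumes "countable I" and d: "integrable (count_space I) d"
  shows "(\<integral>i. d i \<partial>count_space I)\<^sup>2 = (\<integral>(i, j). d i * d j \<partial>count_space (I \<times> I))"
proof -
  interpret I: sigma_finite_measure "count_space I"
    by (rule sigma_finite_measure_count_space_countable) fact
  interpret II: pair_sigma_finite "count_space I" "count_space I" ..
  have prod: "count_space I \<Otimes>\<^sub>M count_space I = count_space (I \<times> I)"
    using assms(1) by (rule pair_measure_countable[OF _ assms(1)])
  have "integrable (count_space I \<Otimes>\<^sub>M count_space I) (\<lambda>(i, j). d i * d j)"
    by (rule II.Fubini_integrable) (use d in \<open>simp_all add: prod abs_mult\<close>)
  then have "(\<integral>(i, j). d i * d j \<partial>(count_space I \<Otimes>\<^sub>M count_space I)) = (\<integral>i. (\<integral>j. d i * d j \<partial>count_space I) \<partial>count_space I)"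
    by (subst II.integral_fst'[symmetric]) auto
  then show ?thesis
    by (simp add: prod power2_eq_square)
qed

lemma nn_integral_count_space_split:
  fixes g :: "'a \<Rightarrow> ennreal"
  assumes "S \<subseteq> A"
  shows "(\<integral>\<^sup>+p. g p \<partial>count_space A) = (\<integral>\<^sup>+p. g p \<partial>count_space S) + (\<integral>\<^sup>+p. g p \<partial>count_space (A - S))"
proof -
  have "(\<integral>\<^sup>+p. g p \<partial>count_space A) = (\<integral>\<^sup>+p. g p * indicator S p + g p * indicator (A - S) p \<partial>count_space A)"
    by (rule nn_integral_cong) (auto split: split_indicator)
  also have "\<dots> = (\<integral>\<^sup>+p. g p \<partial>count_space S) + (\<integral>\<^sup>+p. g p \<partial>count_space (A - S))"
    by (simp add: nn_integral_add nn_integral_count_space_subset[OF assms]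
        nn_integral_count_space_subset[OF Diff_subset])
  finally show ?thesis .
qed

lemma nn_integral_count_space_times:
  fixes g h :: "'a \<Rightarrow> ennreal"
  assumes "countable I"
  shows "(\<integral>\<^sup>+(i, j). g i * h j \<partial>count_space (I \<times> I)) = (\<integral>\<^sup>+i. g i \<partial>count_space I) * (\<integral>\<^sup>+i. h i \<partial>count_space I)"
proof -
  interpret I: sigma_finite_measure "count_space I"
    by (rule sigma_finite_measure_count_space_countable) fact
  have prod: "count_space I \<Otimes>\<^sub>M count_space I = count_space (I \<times> I)"
    using assms(1) by (rule pair_measure_countable[OF _ assms(1)])
  have "(\<integral>\<^sup>+(i, j). g i * h j \<partial>count_space (I \<times> I)) = (\<integral>\<^sup>+i. \<integral>\<^sup>+j. g i * h j \<partial>count_space I \<partial>count_space I)"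
    unfolding prod[symmetric] by (subst I.nn_integral_fst[symmetric]) (simp_all add: prod)
  also have "\<dots> = (\<integral>\<^sup>+i. g i \<partial>count_space I) * (\<integral>\<^sup>+i. h i \<partial>count_space I)"
    by (simp add: nn_integral_cmult nn_integral_multc)
  finally show ?thesis .
qed

text \<open>A variance bound for a weighted sum of random variables that are uncorrelated on pairs
  outside \<open>S\<close>: each pair in \<open>S\<close> contributes a covariance, estimated by the
  second moment plus the product of the means.\<close>

lemma second_moment_weighted_sum_le:
  fixes e :: "'i \<Rightarrow> 'x \<Rightarrow> real" and m f :: "'i \<Rightarrow> real"
  assumes M: "prob_space M" and I: "countable I"
    and e[measurable]: "\<And>i. i \<in> I \<Longrightarrow> e i \<in> borel_measurable M" and e0: "\<And>i x. 0 \<le> e i x"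
    and m0: "\<And>i. 0 \<le> m i" and m: "\<And>i. i \<in> I \<Longrightarrow> (\<integral>\<^sup>+x. e i x \<partial>M) = ennreal (m i)"
    and f: "(\<integral>\<^sup>+i. ennreal (\<bar>f i\<bar> * m i) \<partial>count_space I) < \<infinity>"
    and S: "S \<subseteq> I \<times> I"
    and indep: "\<And>i j. (i, j) \<in> I \<times> I - S \<Longrightarrow> (\<integral>\<^sup>+x. ennreal (e i x * e j x) \<partial>M) = ennreal (m i * m j)"
  shows "(\<integral>\<^sup>+x. ennreal (((\<Sum>\<^sub>\<infinity>i\<in>I. f i * e i x) - (\<integral>i. f i * m i \<partial>count_space I))\<^sup>2) \<partial>M)
    \<le> (\<integral>\<^sup>+(i, j). ennreal \<bar>f i * f j\<bar> * (\<integral>\<^sup>+x. ennreal (e i x * e j x) \<partial>M) \<partial>count_space S)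
      + (\<integral>\<^sup>+(i, j). ennreal (\<bar>f i * f j\<bar> * (m i * m j)) \<partial>count_space S)"
    (is "?L \<le> ?R2 + ?R1")
\<comment> \<open>An infinite \<open>?R2\<close> makes the claim trivial. Otherwise its finiteness
  justifies the exchange of sum and integral.\<close>
proof (cases "?R2 = \<infinity>")
  case False
  interpret prob_space M by fact
  have II: "countable (I \<times> I)" using I by simp
  interpret I: sigma_finite_measure "count_space I"
    by (rule sigma_finite_measure_count_space_countable) fact
  interpret IIs: sigma_finite_measure "count_space (I \<times> I)"
    by (rule sigma_finite_measure_count_space_countable) fact
  interpret P: pair_sigma_finite M "count_space (I \<times> I)" ..
  interpret Q: pair_sigma_finite M "count_space I" ..
  let ?B = "\<lambda>i j. \<integral>\<^sup>+x. ennreal (e i x * e j x) \<partial>M"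
  \<comment> \<open>The pair term of the expanded square, with both factors centred.\<close>
  define F where "F = (\<lambda>(x, i, j). f i * (e i x - m i) * (f j * (e j x - m j)))"
  define A where "A = (\<integral>\<^sup>+i. ennreal (\<bar>f i\<bar> * m i) \<partial>count_space I)"
  \<comment> \<open>With a countable second factor, joint measurability reduces to measurability of
    every slice.\<close>
  have meas: "g \<in> borel_measurable (M \<Otimes>\<^sub>M count_space J)"
    if "countable J" "\<And>p. p \<in> J \<Longrightarrow> (\<lambda>x. g (x, p)) \<in> borel_measurable M"
    for g :: "'x \<times> 'k \<Rightarrow> real" and J :: "'k set"
  proof -
    have "(\<lambda>(p, x). g (x, p)) \<in> borel_measurable (count_space J \<Otimes>\<^sub>M M)"
      using that by (intro measurable_pair_measure_countable1) auto
    from measurable_pair_swap[OF this] show ?thesis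
      by (simp add: case_prod_unfold)
  qed
  have int_e: "integrable M (e i)" and int_e_eq: "(\<integral>x. e i x \<partial>M) = m i" if "i \<in> I" for i
    using m[OF that] e[OF that] e0 m0
    by (auto intro!: integrableI_nn_integral_finite[where x = "m i"] integral_eq_nn_integral[THEN trans])
  have F_meas: "F \<in> borel_measurable (M \<Otimes>\<^sub>M count_space (I \<times> I))"
    by (rule meas[OF II]) (auto simp: F_def)

  have mm: "(\<integral>\<^sup>+(i, j). ennreal (\<bar>f i * f j\<bar> * (m i * m j)) \<partial>count_space (I \<times> I)) = A * A"
    unfolding A_def nn_integral_count_space_times[OF I, symmetric]
    by (rule nn_integral_cong) (auto simp: ennreal_mult[symmetric] m0 abs_mult ac_simps)
  \<comment> \<open>Off \<open>S\<close> the second moments factor, so that part is bounded by the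
    square of the \<open>L^1\<close>-norm \<open>A\<close>; the part on \<open>S\<close> is
    \<open>?R2\<close>.\<close>
  have bb: "(\<integral>\<^sup>+(i, j). ennreal \<bar>f i * f j\<bar> * ?B i j \<partial>count_space (I \<times> I)) < \<infinity>"
  proof -
    have "(\<integral>\<^sup>+(i, j). ennreal \<bar>f i * f j\<bar> * ?B i j \<partial>count_space (I \<times> I - S))
        = (\<integral>\<^sup>+(i, j). ennreal (\<bar>f i * f j\<bar> * (m i * m j)) \<partial>count_space (I \<times> I - S))"
      by (rule nn_integral_cong) (auto simp: indep ennreal_mult m0)
    also have "\<dots> \<le> A * A"
      unfolding mm[symmetric] nn_integral_count_space_split[OF S] by simp
    also have "\<dots> < \<infinity>"
      using f by (simp add: A_def[symmetric] ennreal_mult_less_top)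
    finally show ?thesis
      unfolding nn_integral_count_space_split[OF S] using False by (simp add: less_top)
  qed

  have int_F: "integrable (M \<Otimes>\<^sub>M count_space (I \<times> I)) F"
  proof (rule integrableI_bounded[OF F_meas])
    have "(\<integral>\<^sup>+p. ennreal (norm (F p)) \<partial>(M \<Otimes>\<^sub>M count_space (I \<times> I)))
        = (\<integral>\<^sup>+p. \<integral>\<^sup>+x. ennreal (norm (F (x, p))) \<partial>M \<partial>count_space (I \<times> I))"
      using F_meas by (subst P.nn_integral_snd[symmetric]) auto
    \<comment> \<open>Expanding the centred product gives four terms in absolute value. The three
      other than \<open>e i x * e j x\<close> each integrate to \<open>m i * m j\<close>, which is
      the origin of the factor 3.\<close>
    also have "\<dots> \<le> (\<integral>\<^sup>+(i, j). ennreal \<bar>f i * f j\<bar> * ?B i j + 3 * ennreal (\<bar>f i * f j\<bar> * (m i * m j))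
        \<partial>count_space (I \<times> I))"
    proof (rule nn_integral_mono)
      fix p assume "p \<in> space (count_space (I \<times> I))"
      then obtain i j where p: "p = (i, j)" and i: "i \<in> I" and j: "j \<in> I" by auto
      have "(\<integral>\<^sup>+x. ennreal (norm (F (x, p))) \<partial>M)
          \<le> (\<integral>\<^sup>+x. ennreal \<bar>f i * f j\<bar> * ennreal (e i x * e j x)
            + (ennreal (\<bar>f i * f j\<bar> * m j) * ennreal (e i x) + (ennreal (\<bar>f i * f j\<bar> * m i) * ennreal (e j x)
            + ennreal (\<bar>f i * f j\<bar> * (m i * m j)))) \<partial>M)"
      proof (rule nn_integral_mono)
        fix x
        have "\<bar>(e i x - m i) * (e j x - m j)\<bar> \<le> e i x * e j x + (m j * e i x + (m i * e j x + m i * m j))"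
        proof -
          have "0 \<le> e i x * e j x" "0 \<le> m j * e i x" "0 \<le> m i * e j x" "0 \<le> m i * m j"
            by (simp_all add: e0 m0)
          then show ?thesis
            by (simp add: abs_le_iff algebra_simps)
        qed
        then have "\<bar>f i * f j\<bar> * \<bar>(e i x - m i) * (e j x - m j)\<bar>
            \<le> \<bar>f i * f j\<bar> * (e i x * e j x + (m j * e i x + (m i * e j x + m i * m j)))"
          by (rule mult_left_mono) simp
        moreover have "norm (F (x, p)) = \<bar>f i * f j\<bar> * \<bar>(e i x - m i) * (e j x - m j)\<bar>"
          by (simp add: F_def p abs_mult ac_simps)
        ultimately have "norm (F (x, p)) \<le> \<bar>f i * f j\<bar> * (e i x * e j x) + (\<bar>f i * f j\<bar> * m j * e i x
            + (\<bar>f i * f j\<bar> * m i * e j x + \<bar>f i * f j\<bar> * (m i * m j)))"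
          by (simp add: distrib_left mult.assoc)
        then show "ennreal (norm (F (x, p))) \<le> ennreal \<bar>f i * f j\<bar> * ennreal (e i x * e j x)
            + (ennreal (\<bar>f i * f j\<bar> * m j) * ennreal (e i x) + (ennreal (\<bar>f i * f j\<bar> * m i) * ennreal (e j x)
            + ennreal (\<bar>f i * f j\<bar> * (m i * m j))))"
          by (simp add: e0 m0 ennreal_mult[symmetric] ennreal_plus[symmetric] ennreal_leI del: ennreal_plus)
      qed
      also have "\<dots> = ennreal \<bar>f i * f j\<bar> * ?B i j + (ennreal (\<bar>f i * f j\<bar> * m j) * ennreal (m i)
          + (ennreal (\<bar>f i * f j\<bar> * m i) * ennreal (m j) + ennreal (\<bar>f i * f j\<bar> * (m i * m j))))"
        using i j by (simp add: nn_integral_add nn_integral_cmult m emeasure_space_1)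
      also have "\<dots> = ennreal \<bar>f i * f j\<bar> * ?B i j + 3 * ennreal (\<bar>f i * f j\<bar> * (m i * m j))"
      proof -
        have "ennreal (\<bar>f i * f j\<bar> * m j) * ennreal (m i) = ennreal (\<bar>f i * f j\<bar> * (m i * m j))"
          "ennreal (\<bar>f i * f j\<bar> * m i) * ennreal (m j) = ennreal (\<bar>f i * f j\<bar> * (m i * m j))"
          by (simp_all add: m0 ennreal_mult[symmetric] ac_simps)
        moreover have "a + (a + a) = 3 * a" for a :: ennreal
        proof -
          have "a + (a + a) = (1 + (1 + 1)) * a"
            by (simp only: distrib_right mult_1_left)
          then show ?thesis by simp
        qed
        ultimately show ?thesis by simp
      qed
      finally show "(\<integral>\<^sup>+x. ennreal (norm (F (x, p))) \<partial>M) \<le> (case p of (i, j) \<Rightarrow>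
          ennreal \<bar>f i * f j\<bar> * ?B i j + 3 * ennreal (\<bar>f i * f j\<bar> * (m i * m j)))"
        by (simp add: p)
    qed
    also have "\<dots> = (\<integral>\<^sup>+(i, j). ennreal \<bar>f i * f j\<bar> * ?B i j \<partial>count_space (I \<times> I)) + 3 * (A * A)"
      unfolding mm[symmetric] by (simp add: case_prod_unfold nn_integral_add nn_integral_cmult)
    also have "\<dots> < \<infinity>"
      using bb f by (simp add: A_def[symmetric] ennreal_mult_less_top)
    finally show "(\<integral>\<^sup>+p. ennreal (norm (F p)) \<partial>(M \<Otimes>\<^sub>M count_space (I \<times> I))) < \<infinity>" .
  qed

  have int_m: "integrable (count_space I) (\<lambda>i. f i * m i)"
    using f by (intro integrableI_bounded) (simp_all add: abs_mult m0)
  \<comment> \<open>The expectation of the sum of absolute values is \<open>A\<close>, so the series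
    converges absolutely for almost every \<open>x\<close>. There \<open>infsum\<close> is its
    actual sum and the square may be expanded.\<close>
  have "integrable (M \<Otimes>\<^sub>M count_space I) (\<lambda>(x, i). f i * e i x)"
  proof (rule integrableI_bounded)
    show fe: "(\<lambda>(x, i). f i * e i x) \<in> borel_measurable (M \<Otimes>\<^sub>M count_space I)"
      by (rule meas[OF I]) auto
    have "(\<integral>\<^sup>+p. ennreal (norm (case p of (x, i) \<Rightarrow> f i * e i x)) \<partial>(M \<Otimes>\<^sub>M count_space I))
        = (\<integral>\<^sup>+i. \<integral>\<^sup>+x. ennreal (\<bar>f i\<bar>) * ennreal (e i x) \<partial>M \<partial>count_space I)"
      using fe by (subst Q.nn_integral_snd[symmetric]) (auto simp: abs_mult e0 ennreal_mult[symmetric])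
    also have "\<dots> = A"
      unfolding A_def by (rule nn_integral_cong) (simp add: nn_integral_cmult m ennreal_mult m0)
    finally show "(\<integral>\<^sup>+p. ennreal (norm (case p of (x, i) \<Rightarrow> f i * e i x)) \<partial>(M \<Otimes>\<^sub>M count_space I)) < \<infinity>"
      using f A_def by simp
  qed
  from Q.AE_integrable_fst'[OF this] have "AE x in M. integrable (count_space I) (\<lambda>i. f i * e i x)"
    by simp
  then have square: "AE x in M. ((\<Sum>\<^sub>\<infinity>i\<in>I. f i * e i x) - (\<integral>i. f i * m i \<partial>count_space I))\<^sup>2
      = (\<integral>p. F (x, p) \<partial>count_space (I \<times> I))"
  proof eventually_elim
    case (elim x)
    have "(\<Sum>\<^sub>\<infinity>i\<in>I. f i * e i x) - (\<integral>i. f i * m i \<partial>count_space I)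
        = (\<integral>i. f i * (e i x - m i) \<partial>count_space I)"
      using elim int_m by (simp add: infsum_eq_integral_count_space right_diff_distrib)
    moreover have "integrable (count_space I) (\<lambda>i. f i * (e i x - m i))"
      using elim int_m by (simp add: right_diff_distrib)
    ultimately show ?case
      by (simp add: integral_count_space_square[OF I] F_def)
  qed

  \<comment> \<open>A multiple of the covariance. The second moment is assumed to be a finite real
    \<open>b\<close>, since only then are the products integrable and the Bochner integral equal to
    it.\<close>
  have key: "(\<integral>x. F (x, (i, j)) \<partial>M) = f i * f j * (b - m i * m j)"
    if i: "i \<in> I" and j: "j \<in> I" and b: "?B i j = ennreal b" "0 \<le> b" for i j b
  proof -
    have int: "integrable M (\<lambda>x. e i x * e j x)"
      using i j by (intro integrableI_nn_integral_finite[OF _ _ b(1)]) (simp_all add: e0)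
    have eq: "(\<integral>x. e i x * e j x \<partial>M) = b"
      using i j b by (subst integral_eq_nn_integral) (simp_all add: e0)
    have "F (x, (i, j)) = f i * f j * (e i x * e j x - m j * e i x - m i * e j x + m i * m j)" for x
      by (simp add: F_def algebra_simps)
    then show ?thesis
      using int int_e[OF i] int_e[OF j] by (simp add: eq int_e_eq[OF i] int_e_eq[OF j] prob_space)
  qed
  have F_zero: "(\<integral>x. F (x, p) \<partial>M) = 0" if p: "p \<in> I \<times> I - S" for p
  proof -
    obtain i j where ij: "p = (i, j)" "i \<in> I" "j \<in> I" "(i, j) \<in> I \<times> I - S"
      using p by auto
    show ?thesis
      unfolding ij(1) key[OF ij(2,3) indep[OF ij(4)] mult_nonneg_nonneg[OF m0 m0]] by simp
  qed
  have F_bound: "ennreal (norm (\<integral>x. F (x, p) \<partial>M)) \<le> (case p of (i, j) \<Rightarrow>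
      ennreal \<bar>f i * f j\<bar> * ?B i j + ennreal (\<bar>f i * f j\<bar> * (m i * m j)))" if p': "p \<in> I \<times> I" for p
  proof -
    obtain i j where p: "p = (i, j)" and i: "i \<in> I" and j: "j \<in> I" using p' by auto
    show ?thesis
    proof (cases "?B i j = \<infinity>")
      \<comment> \<open>With an infinite second moment either the coefficient vanishes, and
        \<open>F\<close> with it, or the right-hand side is infinite.\<close>
      case True
      then have "f i * f j = 0 \<or> ennreal \<bar>f i * f j\<bar> * ?B i j = \<infinity>"
        by (auto simp: ennreal_mult_eq_top_iff)
      then show ?thesis
      proof
        assume "f i * f j = 0"
        then have "F (x, p) = 0" for x
          by (auto simp: F_def p)
        then show ?thesis by simp
      qed (simp add: p)
    next
      case False
      then obtain b where b: "?B i j = ennreal b" "0 \<le> b"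
        by (cases "?B i j") auto
      have "0 \<le> m i * m j"
        by (simp add: m0)
      then have "\<bar>b - m i * m j\<bar> \<le> b + m i * m j"
        using b(2) by linarith
      then have "\<bar>f i * f j\<bar> * \<bar>b - m i * m j\<bar> \<le> \<bar>f i * f j\<bar> * (b + m i * m j)"
        by (rule mult_left_mono) simp
      then have "norm (\<integral>x. F (x, p) \<partial>M) \<le> \<bar>f i * f j\<bar> * b + \<bar>f i * f j\<bar> * (m i * m j)"
        unfolding p key[OF i j b] by (simp add: abs_mult distrib_left)
      then have "ennreal (norm (\<integral>x. F (x, p) \<partial>M))
          \<le> ennreal (\<bar>f i * f j\<bar> * b + \<bar>f i * f j\<bar> * (m i * m j))"
        by (rule ennreal_leI)
      also have "\<dots> = ennreal \<bar>f i * f j\<bar> * ?B i j + ennreal (\<bar>f i * f j\<bar> * (m i * m j))"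
        using b m0 by (simp add: ennreal_mult)
      finally show ?thesis
        by (simp add: p)
    qed
  qed

  have "?L = (\<integral>\<^sup>+x. ennreal (\<integral>p. F (x, p) \<partial>count_space (I \<times> I)) \<partial>M)"
    by (rule nn_integral_cong_AE) (use square in \<open>eventually_elim, simp\<close>)
  \<comment> \<open>The inner double sum is almost everywhere a square, hence nonnegative, so the
    integral in \<open>ennreal\<close> becomes a Bochner integral, to which Fubini applies.\<close>
  also have "\<dots> = ennreal (\<integral>x. (\<integral>p. F (x, p) \<partial>count_space (I \<times> I)) \<partial>M)"
  proof (rule nn_integral_eq_integral[OF P.integrable_fst'[OF int_F]])
    show "AE x in M. 0 \<le> (\<integral>p. F (x, p) \<partial>count_space (I \<times> I))"
      using square by eventually_elim (metis zero_le_power2)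
  qed
  also have "(\<integral>x. (\<integral>p. F (x, p) \<partial>count_space (I \<times> I)) \<partial>M) = (\<integral>p. (\<integral>x. F (x, p) \<partial>M) \<partial>count_space (I \<times> I))"
    using P.Fubini_integral[of "\<lambda>x p. F (x, p)"] int_F by simp
  also have "ennreal \<dots> \<le> ennreal (norm (\<integral>p. (\<integral>x. F (x, p) \<partial>M) \<partial>count_space (I \<times> I)))"
    by (rule ennreal_leI) simp
  also have "\<dots> \<le> (\<integral>\<^sup>+p. ennreal (norm (\<integral>x. F (x, p) \<partial>M)) \<partial>count_space (I \<times> I))"
    using P.integrable_snd[of "\<lambda>x p. F (x, p)"] int_F by (intro integral_norm_bound_ennreal) simp
  \<comment> \<open>Only now, after the expectation has been taken, do the pairs outside
    \<open>S\<close> drop out: their covariances are zero, though \<open>F\<close> itself need not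
    be.\<close>
  also have "\<dots> = (\<integral>\<^sup>+p. ennreal (norm (\<integral>x. F (x, p) \<partial>M)) \<partial>count_space S)"
    unfolding nn_integral_count_space_split[OF S]
    using F_zero by (simp add: nn_integral_0_iff_AE AE_count_space)
  also have "\<dots> \<le> (\<integral>\<^sup>+(i, j). ennreal \<bar>f i * f j\<bar> * ?B i j + ennreal (\<bar>f i * f j\<bar> * (m i * m j)) \<partial>count_space S)"
    using F_bound S by (intro nn_integral_mono) auto
  also have "\<dots> = ?R2 + ?R1"
    by (simp add: case_prod_unfold nn_integral_add)
  finally show ?thesis .
qed simp

section \<open>The variance bound\<close>

text \<open>The rule for integrals against a density requires a real-valued one; finiteness of the
  moments allows \<open>enn2real\<close> to replace them.\<close>

lemma integral_moment_measure:
  fixes f :: "'o set \<Rightarrow> real"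
  assumes "\<And>G. G \<in> iso_classes C \<Longrightarrow> moment C \<mu> G < \<infinity>"
  shows "(\<integral>G. f G \<partial>moment_measure C \<mu>)
    = (\<integral>G. f G * enn2real (moment C \<mu> G) \<partial>count_space (iso_classes C))"
proof -
  have "moment_measure C \<mu> = density (count_space (iso_classes C)) (\<lambda>G. ennreal (enn2real (moment C \<mu> G)))"
    unfolding moment_measure_def point_measure_def
    by (rule density_cong) (use assms in \<open>auto simp: AE_count_space\<close>)
  then show ?thesis
    by (simp add: integral_density mult.commute)
qed

text \<open>Passes from lists of length two, used by \<open>mixed_integral\<close>, to the pairs
  over which the variance bound is stated.\<close>

lemma bij_betw_pairs_tuples:
  "bij_betw (\<lambda>(A, B). [A, B])
    (iso_classes C \<times> iso_classes C - {(A, B). [A, B] \<in> T}) (tuples C 2 - T)"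
proof (rule bij_betw_imageI)
  show "(\<lambda>(A, B). [A, B]) ` (iso_classes C \<times> iso_classes C - {(A, B). [A, B] \<in> T}) = tuples C 2 - T"
  proof (intro equalityI subsetI)
    fix Gs assume Gs: "Gs \<in> tuples C 2 - T"
    then obtain A B where "Gs = [A, B]"
      unfolding tuples_def by (auto simp: numeral_2_eq_2 length_Suc_conv)
    then show "Gs \<in> (\<lambda>(A, B). [A, B]) ` (iso_classes C \<times> iso_classes C - {(A, B). [A, B] \<in> T})"
      using Gs by (auto simp: tuples_def)
  qed (auto simp: tuples_def)
qed (auto intro: inj_onI)

lemma mixed_integral_pairs:
  fixes f :: "'o set \<Rightarrow> real"
  assumes "countable (iso_classes C)"
    and S_def: "S = iso_classes C \<times> iso_classes C - {(A, B). [A, B] \<in> T}"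
  shows "mixed_integral C \<mu> j (tuples C 2 - T) f
    = (\<integral>\<^sup>+(A, B). ennreal \<bar>f A * f B\<bar> * mixed_moment C \<mu> (take j [A, B]) *
        (\<Prod>G\<leftarrow>drop j [A, B]. moment C \<mu> G) \<partial>count_space S)"
proof -
  have S: "countable S"
    unfolding S_def using assms(1) by simp
  show ?thesis
    unfolding mixed_integral_def infsum_reindex_bij_betw[OF bij_betw_pairs_tuples, symmetric]
      S_def[symmetric] infsum_ennreal_eq_nn_integral[OF S]
    by (rule nn_integral_cong) auto
qed

text \<open>At every point the two counts multiply to the count of the epi-product, so the mixed
  moment is the moment of that object; the moment condition in \<open>E2\<close> then factors
  it.\<close>

lemma nn_integral_epi_count_E2:
  assumes cat: "category C" and space: "space \<mu> = pro_iso_classes C" and E2: "[A, B] \<in> E2 C \<mu>"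
  shows "(\<integral>\<^sup>+x. ennreal (real (epi_count C x A) * real (epi_count C x B)) \<partial>\<mu>) = moment C \<mu> A * moment C \<mu> B"
proof -
  obtain G1 G2 P p q where AB: "A \<in> iso_classes C" "B \<in> iso_classes C" "G1 \<in> A" "G2 \<in> B"
    and P: "is_epi_product C G1 G2 P p q"
    and M: "moment C \<mu> (iso_class C P) = moment C \<mu> A * moment C \<mu> B"
    using E2 unfolding E2_def by blast
  have "(\<integral>\<^sup>+x. ennreal (real (epi_count C x A) * real (epi_count C x B)) \<partial>\<mu>) = moment C \<mu> (iso_class C P)"
    unfolding moment_def
    by (rule nn_integral_cong)
      (simp add: space epi_count_epi_product[OF cat _ AB(1,3,2,4) P] ennreal_of_nat_eq_real_of_nat)
  then show ?thesis
    using M by simp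
qed

theorem mainTheorem2:
  "\<exists>K::real. K > 0 \<and>
     (\<forall>(C :: ('o, 'a) cat) (\<mu> :: ('i, 'j, 'o, 'a) pro set measure) (f :: nat \<Rightarrow> 'o set \<Rightarrow> real) n.
        diamond_category C \<longrightarrow>
        countable (iso_classes C) \<longrightarrow>
        prob_space \<mu> \<longrightarrow>
        sets \<mu> = sets (level_borel C) \<longrightarrow>
        (\<forall>G\<in>iso_classes C. moment C \<mu> G < \<infinity>) \<longrightarrow>
        L1_ordering C \<mu> f \<longrightarrow>
        (\<integral>\<^sup>+x. ennreal (\<bar>counting_fun C x (f n) - (\<integral>G. f n G \<partial>moment_measure C \<mu>)\<bar>\<^sup>2) \<partial>\<mu>)
          \<le> ennreal K * (MAX j\<in>{1, 2}. mixed_integral C \<mu> j (tuples C 2 - E2 C \<mu>) (f n)))"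
proof (intro exI[of _ 2] conjI allI impI)
  fix C :: "('o, 'a) cat" and \<mu> :: "('i, 'j, 'o, 'a) pro set measure"
    and f :: "nat \<Rightarrow> 'o set \<Rightarrow> real" and n
  assume "diamond_category C" and count: "countable (iso_classes C)" and prob: "prob_space \<mu>"
    and \<mu>: "sets \<mu> = sets (level_borel C)" and fin: "\<forall>G\<in>iso_classes C. moment C \<mu> G < \<infinity>"
    and L1: "L1_ordering C \<mu> f"
  then have cat: "category C"
    by (simp add: diamond_category_def)
  have space: "space \<mu> = pro_iso_classes C"
    using sets_eq_imp_space_eq[OF \<mu>] space_level_borel by simp
  define I where "I = iso_classes C"
  define m where "m = (\<lambda>G. enn2real (moment C \<mu> G))"
  \<comment> \<open>The exceptional pairs: those to which multiplicativity of the second moment does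
    not apply.\<close>
  define S where "S = I \<times> I - {(A, B). [A, B] \<in> E2 C \<mu>}"
  have moment: "moment C \<mu> G = ennreal (m G)" if "G \<in> I" for G
    using fin that by (simp add: m_def I_def less_top)
  have m0: "0 \<le> m G" for G
    by (simp add: m_def)
  have mixed: "mixed_integral C \<mu> j (tuples C 2 - E2 C \<mu>) (f n)
    = (\<integral>\<^sup>+(A, B). ennreal \<bar>f n A * f n B\<bar> * mixed_moment C \<mu> (take j [A, B]) *
        (\<Prod>G\<leftarrow>drop j [A, B]. moment C \<mu> G) \<partial>count_space S)" for j
    by (rule mixed_integral_pairs[OF count]) (simp add: S_def I_def)
  have mixed2: "(\<integral>\<^sup>+(A, B). ennreal \<bar>f n A * f n B\<bar> *
        (\<integral>\<^sup>+x. ennreal (real (epi_count C x A) * real (epi_count C x B)) \<partial>\<mu>) \<partial>count_space S)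
      = mixed_integral C \<mu> 2 (tuples C 2 - E2 C \<mu>) (f n)"
    unfolding mixed
    by (rule nn_integral_cong)
      (auto simp: mixed_moment_def ennreal_of_nat_eq_real_of_nat ennreal_mult)
  have mixed1: "(\<integral>\<^sup>+(A, B). ennreal (\<bar>f n A * f n B\<bar> * (m A * m B)) \<partial>count_space S)
      = mixed_integral C \<mu> 1 (tuples C 2 - E2 C \<mu>) (f n)"
    unfolding mixed
  proof (rule nn_integral_cong, clarify)
    fix A B assume "(A, B) \<in> space (count_space S)"
    then have "A \<in> I" "B \<in> I"
      by (auto simp: S_def)
    \<comment> \<open>For \<open>j = 1\<close> the mixed moment involves one object, so the weight
      of a pair is the product of its two moments.\<close>
    moreover have "mixed_moment C \<mu> [A] = moment C \<mu> A"
      by (simp add: mixed_moment_def moment_def)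
    ultimately show "ennreal (\<bar>f n A * f n B\<bar> * (m A * m B))
        = ennreal \<bar>f n A * f n B\<bar> * mixed_moment C \<mu> (take 1 [A, B]) * (\<Prod>G\<leftarrow>drop 1 [A, B]. moment C \<mu> G)"
      by (simp add: moment m0 ennreal_mult mult.assoc)
  qed
  have "(\<integral>\<^sup>+x. ennreal (\<bar>counting_fun C x (f n) - (\<integral>G. f n G \<partial>moment_measure C \<mu>)\<bar>\<^sup>2) \<partial>\<mu>)
      = (\<integral>\<^sup>+x. ennreal (((\<Sum>\<^sub>\<infinity>G\<in>I. f n G * real (epi_count C x G)) - (\<integral>G. f n G * m G \<partial>count_space I))\<^sup>2) \<partial>\<mu>)"
    unfolding counting_fun_def using fin by (simp add: integral_moment_measure I_def m_def)
  also have "\<dots> \<le> mixed_integral C \<mu> 2 (tuples C 2 - E2 C \<mu>) (f n)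
      + mixed_integral C \<mu> 1 (tuples C 2 - E2 C \<mu>) (f n)"
    unfolding mixed1[symmetric] mixed2[symmetric]
  proof (rule second_moment_weighted_sum_le[OF prob _ _ _ m0])
    show "countable I"
      using count by (simp add: I_def)
    show "(\<lambda>x. real (epi_count C x G)) \<in> borel_measurable \<mu>" if "G \<in> I" for G
      using measurable_epi_count[OF cat \<mu>] that unfolding I_def by measurable
    show "(\<integral>\<^sup>+x. ennreal (real (epi_count C x G)) \<partial>\<mu>) = ennreal (m G)" if "G \<in> I" for G
      using moment[OF that] by (simp add: moment_def ennreal_of_nat_eq_real_of_nat)
    have "(\<integral>\<^sup>+G. ennreal (\<bar>f n G\<bar> * m G) \<partial>count_space I)
        = (\<Sum>\<^sub>\<infinity>G\<in>iso_classes C. ennreal (norm (f n G)) * moment C \<mu> G)"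
      unfolding I_def[symmetric] infsum_ennreal_eq_nn_integral[OF count, folded I_def]
      by (rule nn_integral_cong) (simp add: moment ennreal_mult m0)
    then show "(\<integral>\<^sup>+G. ennreal (\<bar>f n G\<bar> * m G) \<partial>count_space I) < \<infinity>"
      using L1 unfolding L1_ordering_def by simp
    show "(\<integral>\<^sup>+x. ennreal (real (epi_count C x A) * real (epi_count C x B)) \<partial>\<mu>) = ennreal (m A * m B)"
      if "(A, B) \<in> I \<times> I - S" for A B
      using that nn_integral_epi_count_E2[OF cat space, of A B]
      by (simp add: S_def moment ennreal_mult m0)
  qed (auto simp: S_def)
  \<comment> \<open>Each of the two mixed integrals is at most their maximum, so their sum costs a
    factor 2.\<close>
  also have "\<dots> \<le> (MAX j\<in>{1, 2}. mixed_integral C \<mu> j (tuples C 2 - E2 C \<mu>) (f n))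
      + (MAX j\<in>{1, 2}. mixed_integral C \<mu> j (tuples C 2 - E2 C \<mu>) (f n))"
    by (intro add_mono Max_ge) auto
  also have "\<dots> = ennreal 2 * (MAX j\<in>{1, 2}. mixed_integral C \<mu> j (tuples C 2 - E2 C \<mu>) (f n))"
    by (simp add: mult_2)
  finally show "(\<integral>\<^sup>+x. ennreal (\<bar>counting_fun C x (f n) - (\<integral>G. f n G \<partial>moment_measure C \<mu>)\<bar>\<^sup>2) \<partial>\<mu>)
      \<le> ennreal 2 * (MAX j\<in>{1, 2}. mixed_integral C \<mu> j (tuples C 2 - E2 C \<mu>) (f n))" .
qed simp

end
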